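(* Let $f\in\mathscr C$ (an entire function on some $\mathbb C^n$) satisfy the condition $$\lim_{t\to\infty}\frac{\phi_f(t)}{t^2}=\infty.\qquad( * )$$ Then the functions $e^f$, $\sin f$, $\cos f$ belong to $\mathscr C$. In addition, if $f$ is univariate ($n=1$), then its derivative and every antiderivative of it are of class $\mathscr C$ and satisfy $( * )$ (with $f$ replaced by the respective function).
   Context: $\mathbb B^n_r\subset\mathbb C^n$ is the open Euclidean ball of radius $r$ centered at $0$. For an entire function $f$ on $\mathbb C^n$: $M_f(r):=\sup_{\mathbb B^n_r}|f|$, $m_f(r):=\ln M_f(r)$, the order is $\rho_f:=\limsup_{r\to\infty}\frac{\ln m_f(r)}{\ln r}$, and $\phi_f(t):=m_f(e^t)$, $t\in\mathbb R$ (a convex increasing function for nonconstant $f$). Class $\mathscr C$ consists of the nonpolynomial entire functions $f$ satisfying one of the following: (I) $\rho_f<\infty$ and $\limsup_{t\to\infty}\frac{\phi_f(t+1)-\phi_f(t)}{\phi_f(t)-\phi_f(t-1)}<\infty$; (II) $\rho_f=\infty$ and $\lim_{t\to\infty}t^2\left(\frac1{\ln\psi(t)}\right)'=0$ (limit over the points where $\psi'$ exists) for some convex increasing $\psi\in C(\mathbb R)$ with $\lim_{t\to\infty}\frac{\ln\psi(t)}{\ln\phi_f(t)}=1$. *)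

theory Defs
  imports "HOL-Complex_Analysis.Complex_Analysis"
begin

text \<open>Entire functions of several variables: Frechet differentiable at every point, with
  complex-linear derivative.\<close>

definition entire_fun :: "(complex ^ 'n \<Rightarrow> complex) \<Rightarrow> bool" where
  "entire_fun f \<longleftrightarrow>
     (\<forall>z. \<exists>D. (f has_derivative D) (at z) \<and> (\<forall>c v. D (c *s v) = c * D v))"

definition polynomial_fun :: "(complex ^ 'n \<Rightarrow> complex) \<Rightarrow> bool" where
  "polynomial_fun f \<longleftrightarrow>
     (\<exists>(A :: ('n \<Rightarrow> nat) set) c. finite A \<and>
        (\<forall>z. f z = (\<Sum>\<alpha>\<in>A. c \<alpha> * (\<Prod>i\<in>UNIV. (z $ i) ^ \<alpha> i))))"

definition max_modulus :: "(complex ^ 'n \<Rightarrow> complex) \<Rightarrow> real \<Rightarrow> real" where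
  "max_modulus f r = (SUP z\<in>ball 0 r. norm (f z))"

definition log_max_modulus :: "(complex ^ 'n \<Rightarrow> complex) \<Rightarrow> real \<Rightarrow> real" where
  "log_max_modulus f r = ln (max_modulus f r)"

definition growth_order :: "(complex ^ 'n \<Rightarrow> complex) \<Rightarrow> ereal" where
  "growth_order f = Limsup at_top (\<lambda>r. ereal (ln (log_max_modulus f r) / ln r))"

definition phi :: "(complex ^ 'n \<Rightarrow> complex) \<Rightarrow> real \<Rightarrow> real" where
  "phi f t = log_max_modulus f (exp t)"

definition finite_order_cond :: "(complex ^ 'n \<Rightarrow> complex) \<Rightarrow> bool" where
  "finite_order_cond f \<longleftrightarrow>
     growth_order f < \<infinity> \<and>
     Limsup at_top (\<lambda>t. ereal ((phi f (t + 1) - phi f t) / (phi f t - phi f (t - 1)))) < \<infinity>"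

text \<open>The last limit is taken along the points at which \<open>\<psi>\<close> is differentiable, because
  \<^const>\<open>deriv\<close> is an arbitrary value elsewhere. Logarithms of non-positive numbers play no role:
  the middle limit forces \<open>\<psi> \<longrightarrow> \<infinity>\<close>, since \<open>phi f\<close> tends to infinity for nonconstant entire \<open>f\<close>.\<close>

definition infinite_order_cond :: "(complex ^ 'n \<Rightarrow> complex) \<Rightarrow> bool" where
  "infinite_order_cond f \<longleftrightarrow>
     growth_order f = \<infinity> \<and>
     (\<exists>\<psi> :: real \<Rightarrow> real.
        convex_on UNIV \<psi> \<and> mono \<psi> \<and> continuous_on UNIV \<psi> \<and>
        ((\<lambda>t. ln (\<psi> t) / ln (phi f t)) \<longlongrightarrow> 1) at_top \<and>
        ((\<lambda>t. t\<^sup>2 * deriv (\<lambda>s. 1 / ln (\<psi> s)) t) \<longlongrightarrow> 0)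
          (inf at_top (principal {t. \<psi> differentiable (at t)})))"

definition class_C :: "(complex ^ 'n \<Rightarrow> complex) set" where
  "class_C = {f. entire_fun f \<and> \<not> polynomial_fun f \<and>
                 (finite_order_cond f \<or> infinite_order_cond f)}"

definition superquadratic :: "(complex ^ 'n \<Rightarrow> complex) \<Rightarrow> bool" where
  "superquadratic f \<longleftrightarrow> filterlim (\<lambda>t. phi f t / t\<^sup>2) at_top at_top"

text \<open>Identification of functions on the complex plane with functions on \<open>complex ^ 1\<close>.\<close>

definition on_C1 :: "(complex \<Rightarrow> complex) \<Rightarrow> complex ^ 1 \<Rightarrow> complex" where
  "on_C1 g = (\<lambda>z. g (z $ 1))"

end

theory Submission
  imports Defs "HOL-Real_Asymp.Real_Asymp"
begin

text \<open>Write \<open>\<phi> = phi f\<close>. In both types (I) and (II), condition \<open>\<phi> / t\<^sup>2 \<longrightarrow> \<infinity>\<close>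
  forces \<open>t\<^sup>2 \<phi>' / \<phi>\<^sup>2 \<longrightarrow> 0\<close>: for type (I) because \<open>\<phi>' = O(\<phi>)\<close>, for type (II) because
  \<open>1 / ln \<psi>\<close> changes slowly, so that \<open>\<phi> (t + c t\<^sup>2 / ln \<phi> t) \<le> \<phi> t powr (1 + \<delta>)\<close>.
  For \<open>g\<close> one of \<open>exp f\<close>, \<open>sin f\<close>, \<open>cos f\<close>, the Borel--Caratheodory inequality gives
  \<open>ln (phi g) \<sim> \<phi>\<close>, hence \<open>g\<close> has infinite order and \<open>\<psi> = exp \<phi>\<close> witnesses type (II);
  its convexity is Hadamard's three circles theorem. For derivatives and antiderivatives,
  the mean value and Cauchy estimates trap \<open>phi g\<close> between shifts of \<open>\<phi>\<close> up to an error
  \<open>O(t)\<close>, which is negligible against the increments of \<open>\<phi>\<close>.\<close>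

section \<open>Real convexity\<close>

text \<open>Comparing \<open>phi g\<close> with \<phi> costs a shift of the argument:
  Borel--Caratheodory and the Cauchy estimate lose a factor of order 1/s when the radius grows by
  the factor exp s. Unit shifts are harmless in type (I), but in type (II) the quantity t^2 / ln
  \<phi> may tend to 0, and \<phi> (t + 1) need not be bounded by a power of \<phi> t. Hence s is
  tied to \<phi>: for s = 1 / \<phi>^2 or s = 1 / \<phi> the factor 1/s costs only a multiple of ln
  \<phi>, while the shift changes \<phi> in a controlled way. Both \<phi> and \<psi> are convex but
  may fail to be differentiable at some points. Smallness of \<phi>' / \<phi>^2 is therefore
  expressed by secants, which convexity compares with tangents and backward chords, and the
  derivative hypothesis on \<psi> is integrated by a mean value inequality that tolerates countably
  many exceptional points.\<close>

lemma convex_slope_mono: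
  fixes \<phi> :: "real \<Rightarrow> real"
  assumes "convex_on UNIV \<phi>" "a < b" "c < d" "a \<le> c" "b \<le> d"
  shows "(\<phi> b - \<phi> a) / (b - a) \<le> (\<phi> d - \<phi> c) / (d - c)"
proof -
  have 1: "(\<phi> b - \<phi> a) / (b - a) \<le> (\<phi> d - \<phi> a) / (d - a)"
  proof (cases "b = d")
    case False
    then show ?thesis
      using convex_on_slope_le(1)[OF assms(1), of a d b] assms
      by (metis UNIV_I minus_diff_eq minus_divide_divide order_le_less)
  qed simp
  have 2: "(\<phi> d - \<phi> a) / (d - a) \<le> (\<phi> d - \<phi> c) / (d - c)"
  proof (cases "a = c")
    case False
    then show ?thesis
      using convex_on_slope_le(2)[OF assms(1), of a d c] assms
      by (metis UNIV_I minus_diff_eq minus_divide_divide order_le_less)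
  qed simp
  show ?thesis using 1 2 by linarith
qed

text \<open>\<open>D x\<close> is the right derivative, written as an infimum of chord slopes. It is
  monotone, hence continuous off a countable set, and the chord from x to y has slope between
  \<open>D x\<close> and \<open>D y\<close>, so continuity of \<open>D\<close> at x makes the slopes
  converge.\<close>

lemma countable_not_differentiable_convex:
  fixes \<phi> :: "real \<Rightarrow> real"
  assumes c: "convex_on UNIV \<phi>"
  shows "countable {x. \<not> \<phi> differentiable (at x)}"
proof -
  define q where "q x y = (\<phi> y - \<phi> x) / (y - x)" for x y
  define D where "D x = (INF y\<in>{x<..}. q x y)" for x
  have q_sym: "q x y = q y x" for x y
    unfolding q_def by (metis minus_diff_eq minus_divide_divide)
  have q_mono: "q a b \<le> q c d" if "a < b" "c < d" "a \<le> c" "b \<le> d" for a b c d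
    using convex_slope_mono[OF c that] by (simp add: q_def)
  have lower: "q y x \<le> D x" if "y < x" for x y
    unfolding D_def using that by (intro cINF_greatest) (auto intro!: q_mono)
  have upper: "D x \<le> q x y" if "x < y" for x y
    unfolding D_def
  proof (intro cINF_lower bdd_belowI2)
    show "q (x - 1) x \<le> q x z" if "z \<in> {x<..}" for z
      using that by (intro q_mono) auto
  qed (use that in auto)
  have "mono D"
  proof (rule monoI)
    show "D x \<le> D y" if "x \<le> y" for x y
    proof (cases "x = y")
      case False
      then show ?thesis using upper[of x y] lower[of x y] that by force
    qed simp
  qed
  then have "countable {x. \<not> isCont D x}"
    by (rule mono_ctble_discont)
  moreover have "\<phi> differentiable (at x)" if "isCont D x" for x
  proof -
    have lim: "((\<lambda>y. D y) \<longlongrightarrow> D x) (at x)"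
      using that by (simp add: isCont_def)
    have bnd: "min (D x) (D y) \<le> q x y \<and> q x y \<le> max (D x) (D y)" if "y \<noteq> x" for y
      using upper[of x y] lower[of x y] upper[of y x] lower[of y x] that q_sym[of x y]
      by (cases "x < y") auto
    have "((\<lambda>y. q x y) \<longlongrightarrow> D x) (at x)"
    proof (rule tendsto_sandwich)
      show "((\<lambda>y. min (D x) (D y)) \<longlongrightarrow> D x) (at x)"
        using tendsto_min[OF tendsto_const[of "D x"] lim] by simp
      show "((\<lambda>y. max (D x) (D y)) \<longlongrightarrow> D x) (at x)"
        using tendsto_max[OF tendsto_const[of "D x"] lim] by simp
    qed (use bnd in \<open>auto simp: eventually_at_filter\<close>)
    then have "(\<phi> has_real_derivative D x) (at x)"
      by (simp add: has_field_derivative_iff q_def)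
    then show ?thesis
      using real_differentiable_def by blast
  qed
  then have "{x. \<not> \<phi> differentiable (at x)} \<subseteq> {x. \<not> isCont D x}" by blast
  ultimately show ?thesis
    using countable_subset by blast
qed

text \<open>If v b < v a, uncountably many levels lie in between, and the image of the countable set
  \<open>S\<close> misses one of them. At the last point where v is at least this level, v would
  have to increase strictly, contradicting that it is the last.\<close>

lemma le_if_derivative_pos_except_countable:
  fixes v :: "real \<Rightarrow> real"
  assumes cont: "continuous_on {a..b} v" and "countable S" and "a \<le> b"
    and der: "\<And>x. \<lbrakk>a \<le> x; x \<le> b; x \<notin> S\<rbrakk> \<Longrightarrow> \<exists>d>0. (v has_real_derivative d) (at x)"
  shows "v a \<le> v b"
proof (rule ccontr)
  assume "\<not> v a \<le> v b"
  then have "uncountable {v b<..<v a}" by (simp add: uncountable_open_interval)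
  then have "\<not> {v b<..<v a} \<subseteq> v ` S"
    using assms(2) by (meson countable_image countable_subset)
  then obtain y where y: "v b < y" "y < v a" "y \<notin> v ` S"
    by (meson greaterThanLessThan_iff subsetI)
  define A where "A = {x\<in>{a..b}. y \<le> v x}"
  have "closed A"
    unfolding A_def by (intro closed_Collect_le continuous_on_closed_Collect_le continuous_on_const cont) simp
  moreover have "bounded A"
    by (rule bounded_subset[of "{a..b}"]) (auto simp: A_def)
  ultimately have "compact A" by (simp add: compact_eq_bounded_closed)
  moreover have "A \<noteq> {}" using y \<open>a \<le> b\<close> by (auto simp: A_def intro!: exI[of _ a])
  ultimately obtain c where c: "c \<in> A" "\<And>x. x \<in> A \<Longrightarrow> x \<le> c"
    using compact_attains_sup[of A] by auto
  have ab: "a \<le> c" "c \<le> b" "y \<le> v c" using c(1) by (auto simp: A_def)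
  have "c < b" using ab y by (cases "c = b") auto
  have "v c = y"
  proof (rule ccontr)
    assume "v c \<noteq> y"
    then have "y < v c" using ab by simp
    then obtain x where "x \<ge> c" "x \<le> b" "v x = y"
      using IVT2'[of v b y c] y ab continuous_on_subset[OF cont, of "{c..b}"] by auto
    then show False
      using c(2)[of x] ab \<open>v c \<noteq> y\<close> by (auto simp: A_def)
  qed
  then have "c \<notin> S" using y by auto
  then obtain d where "d > 0" "(v has_real_derivative d) (at c)" using der ab by blast
  then obtain e where e: "e > 0" "\<And>h. \<lbrakk>0 < h; h < e\<rbrakk> \<Longrightarrow> v c < v (c + h)"
    using DERIV_pos_inc_right by blast
  define h where "h = min (e / 2) (b - c)"
  have "0 < h" "h < e" "c + h \<le> b" using e \<open>c < b\<close> by (auto simp: h_def)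
  then show False
    using e(2)[of h] c(2)[of "c + h"] \<open>v c = y\<close> ab by (auto simp: A_def)
qed

text \<open>To the right of a the derivative of 1 / ln \<psi> exceeds -1/x^2, hence -1/a^2; the
  bound is the corresponding mean value inequality.\<close>

lemma inverse_ln_decrease:
  fixes \<psi> :: "real \<Rightarrow> real"
  assumes conv: "convex_on UNIV \<psi>" and mono: "mono \<psi>" and "0 < a" "a \<le> b" and gt1: "1 < \<psi> a"
    and der: "\<And>x. \<lbrakk>a \<le> x; \<psi> differentiable (at x)\<rbrakk> \<Longrightarrow> \<bar>x\<^sup>2 * deriv (\<lambda>s. 1 / ln (\<psi> s)) x\<bar> < 1"
  shows "1 / ln (\<psi> a) - 1 / ln (\<psi> b) \<le> (b - a) / a\<^sup>2"
proof -
  \<comment> \<open>The added term has slope 1/a^2, which turns the bound on the derivative into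
    strict positivity off a countable set.\<close>
  define v where "v x = 1 / ln (\<psi> x) + x / a\<^sup>2" for x
  have gt: "1 < \<psi> x" if "a \<le> x" for x using gt1 monoD[OF mono that] by simp
  have "v a \<le> v b"
  proof (rule le_if_derivative_pos_except_countable[OF _ countable_not_differentiable_convex[OF conv] \<open>a \<le> b\<close>])
    have "continuous_on UNIV \<psi>" using convex_on_continuous[OF open_UNIV conv] .
    then have "continuous_on {a..b} \<psi>" by (rule continuous_on_subset) simp
    then show "continuous_on {a..b} v"
      unfolding v_def using gt \<open>0 < a\<close> by (intro continuous_intros) (force simp: ln_eq_zero_iff)+
  next
    fix x assume x: "a \<le> x" "x \<le> b" "x \<notin> {x. \<not> \<psi> differentiable (at x)}"
    then obtain p where p: "(\<psi> has_real_derivative p) (at x)"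
      using real_differentiable_def by blast
    have "((\<lambda>s. 1 / ln (\<psi> s)) has_real_derivative - (p / \<psi> x) / (ln (\<psi> x))\<^sup>2) (at x)"
      using gt[OF x(1)] by (auto intro!: derivative_eq_intros p simp: power2_eq_square)
    then have u: "((\<lambda>s. 1 / ln (\<psi> s)) has_real_derivative deriv (\<lambda>s. 1 / ln (\<psi> s)) x) (at x)"
      using DERIV_imp_deriv by force
    define d where "d = deriv (\<lambda>s. 1 / ln (\<psi> s)) x"
    have "\<bar>x\<^sup>2 * d\<bar> < 1" using der[OF x(1)] x(3) unfolding d_def by simp
    moreover have x2: "x\<^sup>2 \<ge> a\<^sup>2" "a\<^sup>2 > 0" using x \<open>0 < a\<close> by (auto intro: power_mono)
    moreover have "x \<noteq> 0" using x \<open>0 < a\<close> by simp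
    ultimately have "x\<^sup>2 * (d + 1 / x\<^sup>2) > 0" unfolding distrib_left by simp
    then have "d + 1 / x\<^sup>2 > 0" using x2 by (simp add: zero_less_mult_iff)
    moreover have "1 / x\<^sup>2 \<le> 1 / a\<^sup>2" using x2 by (simp add: frac_le)
    ultimately have "d + 1 / a\<^sup>2 > 0" by linarith
    moreover have "(v has_real_derivative d + 1 / a\<^sup>2) (at x)"
      unfolding v_def d_def by (intro DERIV_add u DERIV_cdivide DERIV_ident)
    ultimately show "\<exists>d>0. (v has_real_derivative d) (at x)" by blast
  qed
  then show ?thesis by (simp add: v_def diff_divide_distrib)
qed

section \<open>Maximum modulus\<close>

lemma norm_vector_smult: "norm (c *s v) = norm c * norm (v :: complex ^ 'n)"
  by (simp add: norm_vec_def norm_mult L2_set_right_distrib)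

lemma entire_fun_compose:
  fixes f :: "complex ^ 'n \<Rightarrow> complex"
  assumes "entire_fun f" and h: "h holomorphic_on UNIV"
  shows "entire_fun (\<lambda>z. h (f z))"
  unfolding entire_fun_def
proof
  fix z
  obtain D where D: "(f has_derivative D) (at z)" "\<And>c v. D (c *s v) = c * D v"
    using assms(1) unfolding entire_fun_def by meson
  have "(h has_field_derivative deriv h (f z)) (at (f z))"
    using h by (simp add: holomorphic_derivI)
  then have "((\<lambda>z. h (f z)) has_derivative (\<lambda>v. deriv h (f z) * D v)) (at z)"
    using has_derivative_compose[OF D(1), of h "(*) (deriv h (f z))"]
    by (simp add: has_field_derivative_def)
  with D(2) show "\<exists>D. ((\<lambda>z. h (f z)) has_derivative D) (at z) \<and> (\<forall>c v. D (c *s v) = c * D v)"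
    by (intro exI[of _ "\<lambda>v. deriv h (f z) * D v"]) simp
qed

text \<open>Restriction to complex lines through the origin is how the univariate tools (identity
  theorem, three circles, Schwarz lemma) reach functions of several variables.\<close>

lemma entire_fun_on_line:
  fixes f :: "complex ^ 'n \<Rightarrow> complex"
  assumes "entire_fun f"
  shows "(\<lambda>w. f (w *s v)) holomorphic_on UNIV"
proof -
  have lin: "linear (\<lambda>w. w *s v)"
    by (rule linearI) (simp_all add: vec_eq_iff algebra_simps)
  have "(\<lambda>w. f (w *s v)) field_differentiable (at w)" for w
  proof -
    obtain D where D: "(f has_derivative D) (at (w *s v))" "\<And>c v. D (c *s v) = c * D v"
      using assms unfolding entire_fun_def by meson
    have "((\<lambda>w. w *s v) has_derivative (\<lambda>w. w *s v)) (at w)"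
      using lin by (intro bounded_linear_imp_has_derivative) (simp add: linear_conv_bounded_linear)
    from has_derivative_compose[OF this D(1)]
    have "((\<lambda>w. f (w *s v)) has_derivative (\<lambda>w. D v * w)) (at w)"
      by (simp add: D(2) mult.commute)
    then show ?thesis
      unfolding field_differentiable_def has_field_derivative_def by blast
  qed
  then show ?thesis by (simp add: holomorphic_on_def)
qed

lemma entire_fun_continuous: "entire_fun f \<Longrightarrow> continuous_on S f"
  unfolding entire_fun_def
  by (meson continuous_at_imp_continuous_on has_derivative_continuous)

lemma entire_fun_on_C1: "g holomorphic_on UNIV \<Longrightarrow> entire_fun (on_C1 g)"
proof -
  assume g: "g holomorphic_on UNIV"
  have "entire_fun (\<lambda>z :: complex ^ 1. z $ 1)"
    unfolding entire_fun_def
    by (auto intro!: exI[of _ "\<lambda>z :: complex ^ 1. z $ 1"] bounded_linear_imp_has_derivative bounded_linear_vec_nth)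
  from entire_fun_compose[OF this g] show ?thesis by (simp add: on_C1_def)
qed

lemma holomorphic_if_entire_fun_on_C1:
  assumes "entire_fun (on_C1 g)" shows "g holomorphic_on UNIV"
  using entire_fun_on_line[OF assms, of "vec 1"] by (simp add: on_C1_def)

section \<open>Bounds for an entire function by its maximum modulus\<close>

context
  fixes f :: "complex ^ 'n \<Rightarrow> complex"
  assumes f: "entire_fun f"
begin

lemma bdd_above_norm_entire: "bdd_above ((\<lambda>z. norm (f z)) ` ball 0 r)"
proof -
  have "compact ((\<lambda>z. norm (f z)) ` cball 0 r)"
    by (intro compact_continuous_image continuous_on_norm entire_fun_continuous[OF f]) simp
  then show ?thesis
    by (meson ball_subset_cball bdd_above_mono bounded_imp_bdd_above compact_imp_bounded image_mono)
qed

lemma norm_le_max_modulus_ball: "norm z < r \<Longrightarrow> norm (f z) \<le> max_modulus f r"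
  unfolding max_modulus_def by (intro cSUP_upper bdd_above_norm_entire) simp

text \<open>The three circles argument evaluates f on the bounding spheres themselves, whereas the
  supremum runs over the open ball; continuity bridges the gap.\<close>

lemma norm_le_max_modulus:
  assumes "norm z \<le> r" "0 < r" shows "norm (f z) \<le> max_modulus f r"
proof -
  have "closed {z. norm (f z) \<le> max_modulus f r}"
    by (intro closed_Collect_le continuous_on_norm entire_fun_continuous[OF f] continuous_on_const)
  moreover have "ball 0 r \<subseteq> {z. norm (f z) \<le> max_modulus f r}"
    using norm_le_max_modulus_ball by auto
  ultimately have "closure (ball 0 r) \<subseteq> {z. norm (f z) \<le> max_modulus f r}"
    by (rule closure_minimal[rotated])
  then show ?thesis using assms by (auto simp: closure_ball)
qed

lemma max_modulus_mono:
  assumes "0 < r" "r \<le> s" shows "max_modulus f r \<le> max_modulus f s"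
  unfolding max_modulus_def
  using assms by (intro cSUP_subset_mono bdd_above_norm_entire) auto

lemma max_modulus_nonneg: "0 < r \<Longrightarrow> 0 \<le> max_modulus f r"
  using norm_le_max_modulus[of 0 r] norm_ge_zero[of "f 0"] by (simp del: norm_ge_zero)

end

lemma max_modulus_le:
  assumes "0 < r" "\<And>z. norm z < r \<Longrightarrow> norm (f z) \<le> B"
  shows "max_modulus f r \<le> B"
  unfolding max_modulus_def using assms by (intro cSUP_least) auto

text \<open>A function vanishing near the origin vanishes along the line through \<open>z0\<close>
  by the identity theorem. Positivity makes \<open>phi f\<close> a genuine logarithm, which
  \<open>exp_phi\<close> then inverts.\<close>

lemma max_modulus_pos:
  fixes f :: "complex ^ 'n \<Rightarrow> complex"
  assumes f: "entire_fun f" and z0: "f z0 \<noteq> 0" and r: "0 < r"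
  shows "0 < max_modulus f r"
proof (rule ccontr)
  assume "\<not> 0 < max_modulus f r"
  then have zero: "f z = 0" if "norm z < r" for z
    using norm_le_max_modulus_ball[OF f that] by (smt (verit) norm_le_zero_iff)
  \<comment> \<open>The + 1 in the radius keeps the denominator positive even when \<open>z0\<close>
    is the origin.\<close>
  have "f (1 *s z0) = 0"
  proof (rule analytic_continuation_open[of "ball 0 (r / (norm z0 + 1))" UNIV "\<lambda>w. f (w *s z0)" "\<lambda>_. 0"])
    show "f (w *s z0) = 0" if "w \<in> ball 0 (r / (norm z0 + 1))" for w
    proof (rule zero)
      have "norm w * (norm z0 + 1) < r"
        using that by (simp add: pos_less_divide_eq add_nonneg_pos)
      then show "norm (w *s z0) < r"
        by (simp add: norm_vector_smult distrib_left) (smt (verit) norm_ge_zero)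
    qed
    have "0 < norm z0 + 1" by (simp add: add_nonneg_pos)
    then show "ball 0 (r / (norm z0 + 1)) \<noteq> {}" using r by (metis centre_in_ball divide_pos_pos empty_iff)
  qed (auto intro: entire_fun_on_line[OF f])
  then show False using z0 by simp
qed

text \<open>The maximum over the annulus is pulled back by \<open>exp\<close> to the strip \<open>a < Re s < b\<close>,
  where the comparison function \<open>exp (- \<alpha> s)\<close> is single-valued.\<close>

lemma hadamard_three_circles:
  fixes g :: "complex \<Rightarrow> complex"
  assumes g: "g holomorphic_on UNIV" and "a < b"
    and A: "\<And>w. norm w = exp a \<Longrightarrow> norm (g w) * exp (- \<alpha> * a) \<le> K"
    and B: "\<And>w. norm w = exp b \<Longrightarrow> norm (g w) * exp (- \<alpha> * b) \<le> K"
    and t: "a \<le> t" "t \<le> b" and w: "norm w = exp t"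
  shows "norm (g w) * exp (- \<alpha> * t) \<le> K"
proof -
  \<comment> \<open>The maximum is located on the compact annulus and only then lifted by
    \<open>Ln\<close>; the strip itself is unbounded.\<close>
  define Q where "Q = cball (0::complex) (exp b) - ball 0 (exp a)"
  define H where "H w = norm (g w) * exp (- \<alpha> * ln (norm w))" for w
  have Q: "z \<in> Q \<longleftrightarrow> exp a \<le> norm z \<and> norm z \<le> exp b" for z
    by (auto simp: Q_def)
  have "compact Q" unfolding Q_def by (intro compact_diff) auto
  moreover have "continuous_on Q H"
    unfolding H_def
    using holomorphic_on_imp_continuous_on[OF holomorphic_on_subset[OF g subset_UNIV]]
    by (intro continuous_intros) (auto simp: Q_def)
  moreover have "w \<in> Q" using w t by (simp add: Q)
  ultimately obtain w0 where w0: "w0 \<in> Q" "\<And>z. z \<in> Q \<Longrightarrow> H z \<le> H w0"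
    using continuous_attains_sup[of Q H] by blast
  define s0 where "s0 = Ln w0"
  have "w0 \<noteq> 0" using w0(1) by (auto simp: Q)
  then have s0: "exp s0 = w0" "Re s0 = ln (norm w0)" by (auto simp: s0_def)
  have s0_ab: "a \<le> Re s0" "Re s0 \<le> b"
    using w0(1) ln_mono[of "exp a" "norm w0"] ln_mono[of "norm w0" "exp b"] \<open>w0 \<noteq> 0\<close>
    by (auto simp: Q s0)
  define G where "G s = g (exp s) * exp (- of_real \<alpha> * s)" for s
  have G_norm: "norm (G s) = H (exp s)" for s
    by (simp add: G_def H_def norm_mult)
  have g': "(\<lambda>s. g (exp s)) holomorphic_on UNIV"
    using holomorphic_on_compose_gen[OF holomorphic_on_exp[of UNIV] g subset_UNIV] by (simp add: o_def)
  have G: "G holomorphic_on S" for S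
    unfolding G_def by (intro holomorphic_intros holomorphic_on_subset[OF g'] subset_UNIV)
  have Kab: "norm (G s) \<le> K" if "Re s = a \<or> Re s = b" for s
    using that A[of "exp s"] B[of "exp s"] by (auto simp: G_norm H_def)
  have "norm (G s0) \<le> K"
  proof (cases "Re s0 = a \<or> Re s0 = b")
    case False
    \<comment> \<open>If the maximum is attained at an interior point, G is constant on the strip,
      and its limit at the boundary point \<open>of_real a\<close> brings in the bound K.\<close>
    define S where "S = {s. a < Re s} \<inter> {s. Re s < b}"
    have "open S" unfolding S_def by (intro open_Int open_halfspace_Re_gt open_halfspace_Re_lt)
    moreover have "connected S"
      unfolding S_def by (intro convex_connected convex_Int convex_halfspace_Re_gt convex_halfspace_Re_lt)
    moreover have "norm (G z) \<le> norm (G s0)" if "z \<in> S" for z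
      unfolding G_norm s0 using that by (intro w0) (auto simp: Q S_def)
    moreover have s0S: "s0 \<in> S" using False s0_ab by (auto simp: S_def)
    ultimately have "G constant_on S"
      using maximum_modulus_principle[OF G, of S S s0] by simp
    then have const: "G z = G s0" if "z \<in> S" for z
      using s0S that unfolding constant_on_def by metis
    have "isCont G (of_real a)"
      using holomorphic_on_imp_continuous_on[OF G[of UNIV]] by (simp add: continuous_on_eq_continuous_at)
    then have "((\<lambda>x::real. G (of_real x)) \<longlongrightarrow> G (of_real a)) (at_right a)"
      by (intro isCont_tendsto_compose[where g = G] tendsto_of_real tendsto_ident_at)
    moreover have "\<forall>\<^sub>F x::real in at_right a. G (of_real x) = G s0"
      unfolding eventually_at_right_field
      by (rule exI[of _ b]) (simp add: \<open>a < b\<close> const S_def)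
    then have "((\<lambda>x::real. G (of_real x)) \<longlongrightarrow> G s0) (at_right a)"
      by (rule tendsto_eventually)
    ultimately have "G (of_real a) = G s0"
      by (rule tendsto_unique[OF trivial_limit_at_right_real])
    then show ?thesis using Kab[of "of_real a"] by simp
  qed (use Kab in auto)
  moreover have "H w \<le> norm (G s0)" unfolding G_norm s0 by (rule w0(2)[OF \<open>w \<in> Q\<close>])
  ultimately show ?thesis using w by (simp add: H_def)
qed

section \<open>The function \<open>phi f\<close>: monotonicity and convexity\<close>

context
  fixes f :: "complex ^ 'n \<Rightarrow> complex" and z0
  assumes f: "entire_fun f" and z0: "f z0 \<noteq> 0"
begin

lemma exp_phi: "exp (phi f t) = max_modulus f (exp t)"
  using max_modulus_pos[OF f z0, of "exp t"] by (simp add: phi_def log_max_modulus_def)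

lemma mono_phi: "mono (phi f)"
proof (rule monoI)
  show "phi f s \<le> phi f t" if "s \<le> t" for s t
    using max_modulus_mono[OF f, of "exp s" "exp t"] that by (simp flip: exp_phi)
qed

lemma norm_le_exp_phi: "norm z \<le> exp t \<Longrightarrow> norm (f z) \<le> exp (phi f t)"
  unfolding exp_phi by (rule norm_le_max_modulus[OF f]) auto

lemma phi_le:
  assumes "\<And>z. norm z < exp t \<Longrightarrow> norm (f z) \<le> exp B"
  shows "phi f t \<le> B"
  using max_modulus_le[of "exp t" f "exp B"] assms by (simp flip: exp_phi)

lemma convex_on_phi: "convex_on UNIV (phi f)"
proof (rule convex_on_linorderI)
  fix \<theta> a b :: real
  assume \<theta>: "0 < \<theta>" "\<theta> < 1" and "a < b"
  \<comment> \<open>This exponent makes the maximum modulus times radius^(-\<alpha>) equal at the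
    two radii, so a single K bounds both circles.\<close>
  define \<alpha> where "\<alpha> = (phi f b - phi f a) / (b - a)"
  have \<alpha>: "\<alpha> * (b - a) = phi f b - phi f a" using \<open>a < b\<close> by (simp add: \<alpha>_def)
  have "\<alpha> \<ge> 0" using monoD[OF mono_phi, of a b] \<open>a < b\<close> by (simp add: \<alpha>_def)
  define t where "t = (1 - \<theta>) * a + \<theta> * b"
  have t: "t - a = \<theta> * (b - a)" by (simp add: t_def algebra_simps)
  have "phi f t \<le> phi f a + \<alpha> * (t - a)"
  proof (rule phi_le)
    fix z :: "complex ^ 'n" assume z: "norm z < exp t"
    show "norm (f z) \<le> exp (phi f a + \<alpha> * (t - a))"
    \<comment> \<open>The ball also contains points inside the inner sphere, out of reach of three
      circles; there \<alpha> \<ge> 0 suffices.\<close>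
    proof (cases "norm z \<le> exp a")
      case True
      have "t - a \<ge> 0" using t \<theta> \<open>a < b\<close> by simp
      then have "exp (phi f a) \<le> exp (phi f a + \<alpha> * (t - a))" using \<open>\<alpha> \<ge> 0\<close> by simp
      then show ?thesis using norm_le_exp_phi[OF True] by linarith
    next
      case False
      have "0 < norm z" using False by (smt (verit) exp_gt_zero)
      define s where "s = ln (norm z)"
      have s: "exp s = norm z" using \<open>0 < norm z\<close> by (simp add: s_def)
      have "a \<le> s" "s < t" using False z by (simp_all flip: s)
      define v where "v = inverse (of_real (norm z)) *s z"
      have v: "norm v = 1" using \<open>0 < norm z\<close> by (simp add: v_def norm_vector_smult norm_inverse)
      define K where "K = exp (phi f a - \<alpha> * a)"
      have "norm (f (of_real (norm z) *s v)) * exp (- \<alpha> * s) \<le> K"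
      proof (rule hadamard_three_circles[OF entire_fun_on_line[OF f] \<open>a < b\<close>])
        fix w :: complex assume "norm w = exp a"
        then have "norm (f (w *s v)) \<le> exp (phi f a)"
          by (intro norm_le_exp_phi) (simp add: norm_vector_smult v)
        then have "norm (f (w *s v)) * exp (- \<alpha> * a) \<le> exp (phi f a) * exp (- \<alpha> * a)"
          by (intro mult_right_mono) auto
        then show "norm (f (w *s v)) * exp (- \<alpha> * a) \<le> K"
          by (simp add: K_def flip: exp_add)
      next
        fix w :: complex assume "norm w = exp b"
        then have "norm (f (w *s v)) \<le> exp (phi f b)"
          by (intro norm_le_exp_phi) (simp add: norm_vector_smult v)
        then have "norm (f (w *s v)) * exp (- \<alpha> * b) \<le> exp (phi f b) * exp (- \<alpha> * b)"
          by (intro mult_right_mono) auto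
        also have "\<dots> = exp (phi f b - \<alpha> * b)"
          by (simp flip: exp_add)
        also have "phi f b - \<alpha> * b = phi f a - \<alpha> * a"
          using \<alpha> by (simp add: right_diff_distrib)
        also have "exp \<dots> = K" by (simp add: K_def)
        finally show "norm (f (w *s v)) * exp (- \<alpha> * b) \<le> K" .
      next
        show "s \<le> b" using \<open>s < t\<close> t \<theta> \<open>a < b\<close>
          by (smt (verit) mult_less_cancel_right2)
      qed (use \<open>a \<le> s\<close> s in auto)
      moreover have "of_real (norm z) *s v = z"
        using \<open>0 < norm z\<close> by (simp add: v_def vec_eq_iff)
      ultimately have "norm (f z) * exp (- \<alpha> * s) * exp (\<alpha> * s) \<le> K * exp (\<alpha> * s)"
        by (intro mult_right_mono) auto
      moreover have "norm (f z) * exp (- \<alpha> * s) * exp (\<alpha> * s) = norm (f z)"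
        by (simp add: mult.assoc flip: exp_add)
      ultimately have "norm (f z) \<le> K * exp (\<alpha> * s)" by metis
      also have "\<dots> = exp (phi f a + \<alpha> * (s - a))"
        unfolding K_def exp_add[symmetric] by (simp add: algebra_simps)
      also have "\<dots> \<le> exp (phi f a + \<alpha> * (t - a))"
        using \<open>s < t\<close> \<open>\<alpha> \<ge> 0\<close> by (simp add: mult_left_mono)
      finally show ?thesis .
    qed
  qed
  also have "\<dots> = phi f a + \<theta> * (phi f b - phi f a)"
    using \<alpha> by (simp add: t)
  finally show "phi f ((1 - \<theta>) *\<^sub>R a + \<theta> *\<^sub>R b) \<le> (1 - \<theta>) * phi f a + \<theta> * phi f b"
    by (simp add: t_def algebra_simps)
qed simp

end

text \<open>The Moebius map h / (2 \<beta> - h) sends the half-plane Re h < \<beta> into the unit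
  disc and fixes 0, so the Schwarz lemma applies after rescaling the disc of radius R to the unit
  disc.\<close>

lemma borel_caratheodory:
  assumes g: "g holomorphic_on UNIV" and R: "0 < R" and "0 < \<beta>"
    and Re: "\<And>w. norm w < R \<Longrightarrow> Re (g w - g 0) < \<beta>" and z: "norm z < R"
  shows "norm (g z - g 0) * (R - norm z) \<le> 2 * \<beta> * norm z"
proof -
  define h where "h w = g (of_real R * w) - g 0" for w
  define k where "k w = h w / (2 * of_real \<beta> - h w)" for w
  have Re': "Re (h w) < \<beta>" if "norm w < 1" for w
    unfolding h_def using that R by (intro Re) (simp add: norm_mult)
  have ne: "2 * of_real \<beta> - h w \<noteq> 0" if "norm w < 1" for w
  proof
    assume "2 * of_real \<beta> - h w = 0"
    then have "Re (h w) = 2 * \<beta>" by (simp add: complex_eq_iff)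
    then show False using Re'[OF that] \<open>0 < \<beta>\<close> by simp
  qed
  have "h holomorphic_on ball 0 1"
    unfolding h_def
    using holomorphic_on_compose_gen[OF _ g, of "\<lambda>w. of_real R * w" "ball 0 1"]
    by (auto simp: o_def intro!: holomorphic_intros)
  then have hol: "k holomorphic_on ball 0 1"
    unfolding k_def using ne by (auto intro!: holomorphic_intros)
  have k1: "norm (k w) < 1" if "norm w < 1" for w
  proof -
    \<comment> \<open>This is the difference of the squared moduli of 2 \<beta> - h and h.\<close>
    have "0 < 4 * \<beta> * (\<beta> - Re (h w))" using Re'[OF that] \<open>0 < \<beta>\<close> by simp
    then have "(norm (h w))\<^sup>2 < (norm (2 * of_real \<beta> - h w))\<^sup>2"
      unfolding cmod_power2 by (simp add: power2_eq_square algebra_simps)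
    then have "norm (h w) < norm (2 * of_real \<beta> - h w)"
      by (rule power_less_imp_less_base) simp
    then show ?thesis using ne[OF that] by (simp add: k_def norm_divide)
  qed
  define w where "w = z / of_real R"
  have w: "norm w < 1" "of_real R * w = z" "norm w = norm z / R"
    using z R by (auto simp: w_def norm_divide)
  have "norm (k w) \<le> norm w"
    using Schwarz_Lemma(1)[OF hol _ k1 w(1)] by (simp add: k_def h_def)
  then have "norm (h w) \<le> norm w * norm (2 * of_real \<beta> - h w)"
    using ne[OF w(1)] by (simp add: k_def norm_divide divide_simps)
  also have "\<dots> \<le> norm w * (2 * \<beta> + norm (h w))"
    using norm_triangle_ineq4[of "2 * of_real \<beta>" "h w"] \<open>0 < \<beta>\<close>
    by (intro mult_left_mono) (auto simp: norm_mult)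
  finally have "norm (g z - g 0) \<le> norm z / R * (2 * \<beta> + norm (g z - g 0))"
    by (simp add: w h_def)
  then show ?thesis
    using R by (simp add: field_simps)
qed

section \<open>Growth functions\<close>

definition superquadratic_growth :: "(real \<Rightarrow> real) \<Rightarrow> bool" where
  "superquadratic_growth \<phi> \<longleftrightarrow> filterlim (\<lambda>t. \<phi> t / t\<^sup>2) at_top at_top"

text \<open>For differentiable \<open>\<phi>\<close> this says \<open>t\<^sup>2 \<phi>' / \<phi>\<^sup>2 \<longrightarrow> 0\<close>, which is the derivative condition of
  type (II) for \<open>\<psi> = exp \<phi>\<close>.\<close>

definition slow_secants :: "(real \<Rightarrow> real) \<Rightarrow> bool" where
  "slow_secants \<phi> \<longleftrightarrow>
     (\<forall>\<epsilon>>0. \<forall>\<^sub>F t in at_top. \<exists>s>0. t\<^sup>2 * (\<phi> (t + s) - \<phi> t) \<le> \<epsilon> * s * (\<phi> t)\<^sup>2)"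

section \<open>Real functions of superquadratic growth\<close>

lemma superquadratic_growth_ge:
  assumes "superquadratic_growth \<phi>"
  shows "\<forall>\<^sub>F t in at_top. A * t\<^sup>2 \<le> \<phi> t"
proof -
  have "\<forall>\<^sub>F t in at_top. A \<le> \<phi> t / t\<^sup>2"
    using assms by (simp add: superquadratic_growth_def filterlim_at_top)
  then show ?thesis
    using eventually_gt_at_top[of 0] by eventually_elim (simp add: pos_le_divide_eq)
qed

lemma superquadratic_growthI:
  assumes "superquadratic_growth \<phi>" "0 < c" "\<forall>\<^sub>F t in at_top. c * \<phi> t \<le> \<eta> t"
  shows "superquadratic_growth \<eta>"
  unfolding superquadratic_growth_def filterlim_at_top
proof
  fix A :: real
  show "\<forall>\<^sub>F t in at_top. A \<le> \<eta> t / t\<^sup>2"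
    using superquadratic_growth_ge[OF assms(1), of "A / c"] assms(3) eventually_gt_at_top[of 0]
  proof eventually_elim
    case (elim t)
    then have "A * t\<^sup>2 \<le> c * \<phi> t" using \<open>0 < c\<close> by (simp add: field_simps)
    with elim have "A * t\<^sup>2 \<le> \<eta> t" by linarith
    with elim show ?case by (simp add: pos_le_divide_eq)
  qed
qed

lemma superquadratic_growth_at_top:
  assumes "superquadratic_growth \<phi>"
  shows "filterlim \<phi> at_top at_top"
proof (rule filterlim_at_top_mono[OF filterlim_ident])
  show "\<forall>\<^sub>F t in at_top. t \<le> \<phi> t"
    using superquadratic_growth_ge[OF assms, of 1] eventually_ge_at_top[of 1]
  proof eventually_elim
    case (elim t)
    then show ?case using self_le_power[of t 2] by simp
  qed
qed

text \<open>The chord from 0 to t already has slope at least A t, and the last unit chord is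
  steeper. Thus increments dominate every error linear in t.\<close>

lemma superquadratic_growth_increment:
  assumes "superquadratic_growth \<phi>" and conv: "convex_on UNIV \<phi>"
  shows "\<forall>\<^sub>F t in at_top. A * t \<le> \<phi> t - \<phi> (t - 1)"
  using superquadratic_growth_ge[OF assms(1), of "\<bar>A\<bar> + \<bar>\<phi> 0\<bar>"] eventually_ge_at_top[of 1]
proof eventually_elim
  case (elim t)
  have "\<bar>\<phi> 0\<bar> * 1 \<le> \<bar>\<phi> 0\<bar> * t\<^sup>2" using elim by (intro mult_left_mono) auto
  then have "\<bar>A\<bar> * t\<^sup>2 \<le> \<phi> t - \<phi> 0" using elim by (simp add: distrib_right)
  moreover have "A * t\<^sup>2 \<le> \<bar>A\<bar> * t\<^sup>2" by (intro mult_right_mono) auto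
  ultimately have "A * t\<^sup>2 \<le> \<phi> t - \<phi> 0" by linarith
  then have "A * t \<le> (\<phi> t - \<phi> 0) / (t - 0)"
    using elim by (simp add: field_simps power2_eq_square)
  also have "\<dots> \<le> (\<phi> t - \<phi> (t - 1)) / (t - (t - 1))"
    using elim by (intro convex_slope_mono[OF conv]) auto
  finally show ?case by simp
qed

text \<open>The secant of length s = 1 works: its rise is at most |C| times \<phi> t, and
  superquadratic growth lets one factor \<phi> t absorb |C| t^2 / \<epsilon>.\<close>

lemma slow_secants_if_increments_bounded:
  assumes sq: "superquadratic_growth \<phi>" and conv: "convex_on UNIV \<phi>"
    and C: "\<forall>\<^sub>F t in at_top. (\<phi> (t + 1) - \<phi> t) / (\<phi> t - \<phi> (t - 1)) \<le> C"
  shows "slow_secants \<phi>"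
  unfolding slow_secants_def
proof (intro allI impI)
  fix \<epsilon> :: real assume "\<epsilon> > 0"
  have "filterlim (\<lambda>t::real. t - 1) at_top at_top" by real_asymp
  from filterlim_compose[OF superquadratic_growth_at_top[OF sq] this]
  have "\<forall>\<^sub>F t in at_top. 0 \<le> \<phi> (t - 1)"
    by (simp add: filterlim_at_top)
  then show "\<forall>\<^sub>F t in at_top. \<exists>s>0. t\<^sup>2 * (\<phi> (t + s) - \<phi> t) \<le> \<epsilon> * s * (\<phi> t)\<^sup>2"
    using C superquadratic_growth_increment[OF sq conv, of 1] eventually_gt_at_top[of 0]
      superquadratic_growth_ge[OF sq, of "\<bar>C\<bar> / \<epsilon>"]
  proof eventually_elim
    case (elim t)
    have inc: "0 < \<phi> t - \<phi> (t - 1)" using elim by linarith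
    then have "\<phi> (t + 1) - \<phi> t \<le> C * (\<phi> t - \<phi> (t - 1))"
      using elim(2) by (simp add: pos_divide_le_eq)
    also have "\<dots> \<le> \<bar>C\<bar> * \<phi> t"
      using inc elim(1) by (intro mult_mono) auto
    finally have "t\<^sup>2 * (\<phi> (t + 1) - \<phi> t) \<le> t\<^sup>2 * (\<bar>C\<bar> * \<phi> t)"
      by (intro mult_left_mono) auto
    also have "\<dots> = (\<bar>C\<bar> / \<epsilon> * t\<^sup>2) * (\<epsilon> * \<phi> t)" using \<open>\<epsilon> > 0\<close> by simp
    also have "\<dots> \<le> \<phi> t * (\<epsilon> * \<phi> t)"
      using elim inc \<open>\<epsilon> > 0\<close> by (intro mult_right_mono) auto
    finally show ?case by (intro exI[of _ 1]) (simp add: power2_eq_square algebra_simps)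
  qed
qed

text \<open>Over a step c t^2 / ln \<phi>, the function 1 / ln \<psi> drops by at most c / ln
  \<phi>, a small fraction of itself. Hence ln \<psi>, and with it ln \<phi>, grows at most by a
  factor close to 1.\<close>

lemma eventually_le_powr_if_ln_regular:
  fixes \<phi> \<psi> :: "real \<Rightarrow> real"
  assumes \<phi>: "filterlim \<phi> at_top at_top"
    and conv: "convex_on UNIV \<psi>" and mono: "mono \<psi>"
    and lim: "((\<lambda>t. ln (\<psi> t) / ln (\<phi> t)) \<longlongrightarrow> 1) at_top"
    and der: "((\<lambda>t. t\<^sup>2 * deriv (\<lambda>s. 1 / ln (\<psi> s)) t) \<longlongrightarrow> 0)
          (inf at_top (principal {t. \<psi> differentiable (at t)}))"
    and \<delta>: "0 < \<delta>" "\<delta> \<le> 1"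
  shows "\<forall>\<^sub>F t in at_top. \<phi> (t + \<delta> / 8 * t\<^sup>2 / ln (\<phi> t)) \<le> \<phi> t powr (1 + \<delta>)"
proof -
  define c where "c = \<delta> / 8"
  have c: "0 < c" "c \<le> 1 / 8" "\<delta> = 8 * c" using \<delta> by (auto simp: c_def)
  have \<phi>1: "\<forall>\<^sub>F t in at_top. A < \<phi> t" for A
    using \<phi> by (simp add: filterlim_at_top_dense)
  have "\<forall>\<^sub>F t in at_top. dist (ln (\<psi> t) / ln (\<phi> t)) 1 < c"
    using lim c(1) by (rule tendstoD)
  with \<phi>1[of 1] have cmp: "\<forall>\<^sub>F t in at_top. (1 - c) * ln (\<phi> t) \<le> ln (\<psi> t) \<and> ln (\<psi> t) \<le> (1 + c) * ln (\<phi> t)"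
  proof eventually_elim
    case (elim t)
    then have "0 < ln (\<phi> t)" by simp
    with elim show ?case by (auto simp: dist_real_def abs_less_iff field_simps)
  qed
  \<comment> \<open>Here \<open>ln\<close> is even, so a negative \<psi> of large modulus has to be
    excluded. If \<psi> \<le> 1 throughout, monotonicity bounds its modulus for t \<ge> 0, while ln
    \<psi> must follow ln \<phi> to infinity.\<close>
  have "\<exists>x. 1 < \<psi> x"
  proof (rule ccontr)
    assume "\<nexists>x. 1 < \<psi> x"
    then have le1: "\<psi> x \<le> 1" for x by (simp add: not_less)
    define M where "M = max 1 \<bar>\<psi> 0\<bar>"
    have "\<forall>\<^sub>F t::real in at_top. t \<noteq> t"
      using cmp \<phi>1[of "exp (ln M / (1 - c))"] eventually_ge_at_top[of 0]
    proof eventually_elim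
      case (elim t)
      have "\<bar>\<psi> t\<bar> \<le> M" using le1[of t] monoD[OF mono elim(3)] by (auto simp: M_def)
      moreover have "ln (\<psi> t) = ln \<bar>\<psi> t\<bar>" by (cases "\<psi> t \<ge> 0") (auto simp: ln_minus)
      ultimately have "ln (\<psi> t) \<le> ln M" by (cases "\<psi> t = 0") (auto simp: M_def)
      moreover have "ln M / (1 - c) < ln (\<phi> t)"
        using elim(2) by (metis exp_gt_zero ln_exp ln_less_cancel_iff order.strict_trans)
      then have "ln M < (1 - c) * ln (\<phi> t)" using c by (simp add: field_simps)
      ultimately have False using elim(1) by linarith
      then show ?case ..
    qed
    then show False by simp
  qed
  then obtain x0 where "1 < \<psi> x0" by blast
  then have "\<forall>\<^sub>F t in at_top. 1 < \<psi> t"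
    using monoD[OF mono, of x0] by (intro eventually_mono[OF eventually_ge_at_top[of x0]]) force
  moreover have "\<forall>\<^sub>F t in at_top. \<psi> differentiable (at t) \<longrightarrow> \<bar>t\<^sup>2 * deriv (\<lambda>s. 1 / ln (\<psi> s)) t\<bar> < 1"
    using tendstoD[OF der, of 1] by (simp add: eventually_inf_principal)
  ultimately have "\<forall>\<^sub>F t in at_top. 0 < t \<and> 1 < \<phi> t \<and> 1 < \<psi> t
      \<and> (1 - c) * ln (\<phi> t) \<le> ln (\<psi> t) \<and> ln (\<psi> t) \<le> (1 + c) * ln (\<phi> t)
      \<and> (\<psi> differentiable (at t) \<longrightarrow> \<bar>t\<^sup>2 * deriv (\<lambda>s. 1 / ln (\<psi> s)) t\<bar> < 1)"
    using cmp \<phi>1[of 1] eventually_gt_at_top[of 0] by eventually_elim simp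
  then obtain T where T: "\<And>t. t \<ge> T \<Longrightarrow> 0 < t \<and> 1 < \<phi> t \<and> 1 < \<psi> t
      \<and> (1 - c) * ln (\<phi> t) \<le> ln (\<psi> t) \<and> ln (\<psi> t) \<le> (1 + c) * ln (\<phi> t)
      \<and> (\<psi> differentiable (at t) \<longrightarrow> \<bar>t\<^sup>2 * deriv (\<lambda>s. 1 / ln (\<psi> s)) t\<bar> < 1)"
    unfolding eventually_at_top_linorder by blast
  have "\<phi> (t + \<delta> / 8 * t\<^sup>2 / ln (\<phi> t)) \<le> \<phi> t powr (1 + \<delta>)" if t: "t \<ge> T" for t
  proof -
    define l where "l = ln (\<phi> t)"
    define b where "b = t + c * t\<^sup>2 / l"
    define L where "L = ln (\<phi> b)"
    have "0 < l" "0 < t" using T[OF t] by (auto simp: l_def)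
    then have "t \<le> b" using c by (simp add: b_def)
    with t have "T \<le> b" by simp
    have "0 < L" using T[OF \<open>T \<le> b\<close>] by (simp add: L_def)
    have "1 / ln (\<psi> t) - 1 / ln (\<psi> b) \<le> (b - t) / t\<^sup>2"
      using t T by (intro inverse_ln_decrease conv mono \<open>t \<le> b\<close>) auto
    also have "\<dots> = c / l" using \<open>0 < t\<close> by (simp add: b_def)
    finally have "1 / ln (\<psi> t) - c / l \<le> 1 / ln (\<psi> b)" by linarith
    moreover have "1 / ((1 + c) * l) \<le> 1 / ln (\<psi> t)"
      using T[OF t] by (intro frac_le) (auto simp: l_def)
    moreover have "1 / ln (\<psi> b) \<le> 1 / ((1 - c) * L)"
      using T[OF \<open>T \<le> b\<close>] c \<open>0 < L\<close> by (intro frac_le) (auto simp: L_def)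
    ultimately have "1 / ((1 + c) * l) - c / l \<le> 1 / ((1 - c) * L)" by linarith
    moreover have "1 / ((1 + c) * l) - c / l = (1 - c * (1 + c)) / ((1 + c) * l)"
      using c \<open>0 < l\<close> by (simp add: diff_divide_distrib)
    ultimately have "(1 - c * (1 + c)) / ((1 + c) * l) \<le> 1 / ((1 - c) * L)" by simp
    moreover have "0 < (1 + c) * l" "0 < (1 - c) * L" using c \<open>0 < l\<close> \<open>0 < L\<close> by auto
    ultimately have "(1 - c * (1 + c)) * (1 - c) * L \<le> (1 + c) * l"
      by (simp only: pos_le_divide_eq times_divide_eq_left pos_divide_le_eq mult_1_left mult.assoc)
    \<comment> \<open>The product of the two factors on the right is 1 - 2 c + c^3.\<close>
    moreover have "(1 - 2 * c) * L \<le> (1 - c * (1 + c)) * (1 - c) * L"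
      using c \<open>0 < L\<close> by (intro mult_right_mono) (auto simp: algebra_simps)
    ultimately have "(1 - 2 * c) * L \<le> (1 + c) * l" by linarith
    also have "\<dots> \<le> ((1 - 2 * c) * (1 + \<delta>)) * l"
    proof (rule mult_right_mono)
      \<comment> \<open>With \<delta> = 8 c the claim becomes 16 c^2 \<le> 5 c, which c \<le> 1/8
        guarantees.\<close>
      have "16 * c * c \<le> 16 * (1 / 8) * c" using c by (intro mult_right_mono) auto
      then show "1 + c \<le> (1 - 2 * c) * (1 + \<delta>)" using c by (simp add: algebra_simps)
    qed (use \<open>0 < l\<close> in simp)
    finally have "(1 - 2 * c) * L \<le> (1 - 2 * c) * ((1 + \<delta>) * l)" by (simp only: mult.assoc)
    then have "L \<le> (1 + \<delta>) * l" using c by (subst (asm) mult_le_cancel_left_pos) auto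
    then have "exp L \<le> exp ((1 + \<delta>) * l)" by simp
    moreover have "exp L = \<phi> b" using T[OF \<open>T \<le> b\<close>] by (simp add: L_def)
    moreover have "exp ((1 + \<delta>) * l) = \<phi> t powr (1 + \<delta>)" using T[OF t] by (simp add: l_def powr_def)
    moreover have "b = t + \<delta> / 8 * t\<^sup>2 / ln (\<phi> t)" by (simp only: b_def c_def l_def)
    ultimately show ?thesis by simp
  qed
  then show ?thesis unfolding eventually_at_top_linorder by blast
qed

text \<open>The step s = c t^2 / ln \<phi> carries the factor t^2 of the secant condition, so only
  \<phi>^(3/2) ln \<phi> = o(\<phi>^2) remains to be used.\<close>

lemma slow_secants_if_le_powr:
  assumes \<phi>: "filterlim \<phi> at_top at_top" and "0 < c"
    and le: "\<forall>\<^sub>F t in at_top. \<phi> (t + c * t\<^sup>2 / ln (\<phi> t)) \<le> \<phi> t powr (3 / 2)"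
  shows "slow_secants \<phi>"
  unfolding slow_secants_def
proof (intro allI impI)
  fix \<epsilon> :: real assume "\<epsilon> > 0"
  have "((\<lambda>x::real. x powr (3 / 2) * ln x / x\<^sup>2) \<longlongrightarrow> 0) at_top" by real_asymp
  moreover have "0 < c * \<epsilon>" using \<open>\<epsilon> > 0\<close> \<open>0 < c\<close> by simp
  ultimately have "\<forall>\<^sub>F x::real in at_top. x powr (3 / 2) * ln x / x\<^sup>2 < c * \<epsilon>"
    by (rule order_tendstoD)
  from eventually_compose_filterlim[OF this \<phi>]
    eventually_compose_filterlim[OF eventually_gt_at_top[of 1] \<phi>] le eventually_gt_at_top[of 0]
  show "\<forall>\<^sub>F t in at_top. \<exists>s>0. t\<^sup>2 * (\<phi> (t + s) - \<phi> t) \<le> \<epsilon> * s * (\<phi> t)\<^sup>2"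
  proof eventually_elim
    case (elim t)
    define s where "s = c * t\<^sup>2 / ln (\<phi> t)"
    have "0 < ln (\<phi> t)" using elim by simp
    then have "0 < s" using \<open>0 < c\<close> elim by (simp add: s_def)
    have "t\<^sup>2 * (\<phi> (t + s) - \<phi> t) \<le> t\<^sup>2 * \<phi> t powr (3 / 2)"
      using elim by (intro mult_left_mono) (auto simp: s_def)
    also have "\<dots> = t\<^sup>2 / ln (\<phi> t) * (\<phi> t powr (3 / 2) * ln (\<phi> t))"
      using \<open>0 < ln (\<phi> t)\<close> by simp
    also have "\<dots> \<le> t\<^sup>2 / ln (\<phi> t) * (c * \<epsilon> * (\<phi> t)\<^sup>2)"
      using elim \<open>0 < ln (\<phi> t)\<close> by (intro mult_left_mono) (auto simp: pos_divide_less_eq)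
    also have "\<dots> = \<epsilon> * s * (\<phi> t)\<^sup>2" by (simp add: s_def)
    finally show ?case using \<open>0 < s\<close> by blast
  qed
qed

text \<open>By convexity the backward slope at t is at most a forward one, hence at most \<phi>^2 /
  t^2 \<le> \<phi>^2. Moving back by 1 / \<phi>^2 therefore loses at most 1, which fixes the shift
  used in the lower bounds for \<open>phi g\<close>.\<close>

lemma slow_secants_backward:
  assumes "slow_secants \<phi>" and conv: "convex_on UNIV \<phi>" and \<phi>: "filterlim \<phi> at_top at_top"
  shows "\<forall>\<^sub>F t in at_top. \<phi> t - 1 \<le> \<phi> (t - 1 / (\<phi> t)\<^sup>2)"
proof -
  have "\<forall>\<^sub>F t in at_top. \<exists>s>0. t\<^sup>2 * (\<phi> (t + s) - \<phi> t) \<le> 1 * s * (\<phi> t)\<^sup>2"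
    using assms(1) unfolding slow_secants_def by (meson zero_less_one)
  with eventually_compose_filterlim[OF eventually_gt_at_top[of 0] \<phi>] eventually_ge_at_top[of 1]
  show ?thesis
  proof eventually_elim
    case (elim t)
    then obtain s where s: "0 < s" "t\<^sup>2 * (\<phi> (t + s) - \<phi> t) \<le> s * (\<phi> t)\<^sup>2" by auto
    define r where "r = 1 / (\<phi> t)\<^sup>2"
    have "0 < r" using elim by (simp add: r_def)
    have "(\<phi> t - \<phi> (t - r)) / (t - (t - r)) \<le> (\<phi> (t + s) - \<phi> t) / ((t + s) - t)"
      using s \<open>0 < r\<close> by (intro convex_slope_mono[OF conv]) auto
    also have "\<dots> \<le> (\<phi> t)\<^sup>2 / t\<^sup>2" using s elim by (simp add: field_simps)
    also have "\<dots> \<le> (\<phi> t)\<^sup>2 / 1" using elim by (intro divide_left_mono) auto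
    finally have "\<phi> t - \<phi> (t - r) \<le> (\<phi> t)\<^sup>2 * r" using \<open>0 < r\<close> by (simp add: pos_divide_le_eq)
    also have "\<dots> = 1" using elim by (simp add: r_def)
    finally show ?case by (simp add: r_def)
  qed
qed

text \<open>A convex graph lies above its tangents, so \<phi>' is at most any forward secant slope,
  in particular the one supplied by \<open>slow_secants\<close>.\<close>

lemma slow_secants_deriv_inverse:
  assumes slow: "slow_secants \<phi>" and conv: "convex_on UNIV \<phi>" and mono: "mono \<phi>"
    and \<phi>: "filterlim \<phi> at_top at_top"
  shows "((\<lambda>t. t\<^sup>2 * deriv (\<lambda>s. 1 / \<phi> s) t) \<longlongrightarrow> 0)
           (inf at_top (principal {t. \<phi> differentiable (at t)}))"
proof (rule tendstoI)
  fix \<epsilon> :: real assume "\<epsilon> > 0"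
  then have "\<forall>\<^sub>F t in at_top. \<exists>s>0. t\<^sup>2 * (\<phi> (t + s) - \<phi> t) \<le> \<epsilon> / 2 * s * (\<phi> t)\<^sup>2"
    using slow unfolding slow_secants_def by (meson half_gt_zero)
  with eventually_compose_filterlim[OF eventually_gt_at_top[of 0] \<phi>]
  have "\<forall>\<^sub>F t in at_top. \<phi> differentiable (at t) \<longrightarrow> \<bar>t\<^sup>2 * deriv (\<lambda>s. 1 / \<phi> s) t\<bar> < \<epsilon>"
  proof eventually_elim
    case (elim t)
    show ?case
    proof
      assume "\<phi> differentiable (at t)"
      then obtain p where p: "(\<phi> has_real_derivative p) (at t)"
        using real_differentiable_def by blast
      obtain s where s: "0 < s" "t\<^sup>2 * (\<phi> (t + s) - \<phi> t) \<le> \<epsilon> / 2 * s * (\<phi> t)\<^sup>2"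
        using elim by blast
      have "\<phi> (t + s) - \<phi> t \<ge> p * ((t + s) - t)"
        using p by (intro convex_on_imp_above_tangent[OF conv]) auto
      then have "t\<^sup>2 * (p * s) \<le> t\<^sup>2 * (\<phi> (t + s) - \<phi> t)"
        by (intro mult_left_mono) auto
      also note s(2)
      finally have "s * (t\<^sup>2 * p) \<le> s * (\<epsilon> / 2 * (\<phi> t)\<^sup>2)" by (simp add: algebra_simps)
      then have le: "t\<^sup>2 * p \<le> \<epsilon> / 2 * (\<phi> t)\<^sup>2" using s(1) by (rule mult_left_le_imp_le)
      have "\<phi> (t - 1) - \<phi> t \<ge> p * ((t - 1) - t)"
        using p by (intro convex_on_imp_above_tangent[OF conv]) auto
      then have "0 \<le> p" using monoD[OF mono, of "t - 1" t] by simp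
      have "((\<lambda>s. 1 / \<phi> s) has_real_derivative - p / (\<phi> t)\<^sup>2) (at t)"
        using elim by (auto intro!: derivative_eq_intros p simp: power2_eq_square)
      then have "deriv (\<lambda>s. 1 / \<phi> s) t = - p / (\<phi> t)\<^sup>2" by (rule DERIV_imp_deriv)
      then have "\<bar>t\<^sup>2 * deriv (\<lambda>s. 1 / \<phi> s) t\<bar> = t\<^sup>2 * p / (\<phi> t)\<^sup>2"
        using \<open>0 \<le> p\<close> by (simp add: abs_mult)
      also have "\<dots> \<le> \<epsilon> / 2" using le elim by (simp add: pos_divide_le_eq)
      also have "\<dots> < \<epsilon>" using \<open>\<epsilon> > 0\<close> by simp
      finally show "\<bar>t\<^sup>2 * deriv (\<lambda>s. 1 / \<phi> s) t\<bar> < \<epsilon>" .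
    qed
  qed
  then show "\<forall>\<^sub>F t in inf at_top (principal {t. \<phi> differentiable (at t)}).
      dist (t\<^sup>2 * deriv (\<lambda>s. 1 / \<phi> s) t) 0 < \<epsilon>"
    by (simp add: eventually_inf_principal)
qed

text \<open>Type (II) sees \<phi> only through ln \<phi> up to a factor tending to 1: the constant
  1/2 shifts ln \<phi> by ln 2, and the power 1 + \<delta> multiplies it by 1 + \<delta>.\<close>

lemma ln_ratio_tendsto_1:
  fixes \<phi> \<eta> :: "real \<Rightarrow> real"
  assumes \<phi>: "filterlim \<phi> at_top at_top"
    and lower: "\<forall>\<^sub>F t in at_top. \<phi> t / 2 \<le> \<eta> t"
    and upper: "\<And>\<delta>. \<lbrakk>0 < \<delta>; \<delta> \<le> 1\<rbrakk> \<Longrightarrow> \<forall>\<^sub>F t in at_top. \<eta> t \<le> \<phi> t powr (1 + \<delta>)"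
  shows "((\<lambda>t. ln (\<eta> t) / ln (\<phi> t)) \<longlongrightarrow> 1) at_top"
proof (rule tendstoI)
  fix \<epsilon> :: real assume "\<epsilon> > 0"
  define \<delta> where "\<delta> = min (\<epsilon> / 2) 1"
  have \<delta>: "0 < \<delta>" "\<delta> \<le> 1" "\<delta> < \<epsilon>" using \<open>\<epsilon> > 0\<close> by (auto simp: \<delta>_def)
  have "((\<lambda>x::real. (ln x - ln 2) / ln x) \<longlongrightarrow> 1) at_top" by real_asymp
  then have "\<forall>\<^sub>F x::real in at_top. 1 - \<epsilon> < (ln x - ln 2) / ln x"
    using \<open>\<epsilon> > 0\<close> by (intro order_tendstoD) auto
  from eventually_compose_filterlim[OF this \<phi>] lower upper[OF \<delta>(1,2)]
    eventually_compose_filterlim[OF eventually_gt_at_top[of 2] \<phi>]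
  show "\<forall>\<^sub>F t in at_top. dist (ln (\<eta> t) / ln (\<phi> t)) 1 < \<epsilon>"
  proof eventually_elim
    case (elim t)
    have pos: "0 < ln (\<phi> t)" "0 < \<eta> t" using elim by auto
    have "ln (\<phi> t / 2) \<le> ln (\<eta> t)" using elim by (intro ln_mono) auto
    then have "(ln (\<phi> t) - ln 2) / ln (\<phi> t) \<le> ln (\<eta> t) / ln (\<phi> t)"
      using elim pos by (intro divide_right_mono) (auto simp: ln_div)
    moreover have "ln (\<eta> t) \<le> ln (\<phi> t powr (1 + \<delta>))" using elim pos by (intro ln_mono) auto
    then have "ln (\<eta> t) / ln (\<phi> t) \<le> 1 + \<delta>" using elim pos by (simp add: pos_divide_le_eq)
    ultimately show ?case using elim \<delta> by (auto simp: dist_real_def abs_less_iff)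
  qed
qed

text \<open>Up to linear errors, the increment of \<eta> after t is covered by three unit increments
  of \<phi>, while the one before t is bounded below by a single earlier increment d. Iterating the
  hypothesis bounds the former by powers of D times d, and the linear errors are small against
  d.\<close>

lemma increments_bounded_transfer:
  fixes \<phi> \<eta> :: "real \<Rightarrow> real"
  assumes sq: "superquadratic_growth \<phi>" and conv: "convex_on UNIV \<phi>" and conv': "convex_on UNIV \<eta>"
    and C: "\<forall>\<^sub>F t in at_top. (\<phi> (t + 1) - \<phi> t) / (\<phi> t - \<phi> (t - 1)) \<le> C"
    and lower: "\<forall>\<^sub>F t in at_top. \<phi> (t - 1) - K * t \<le> \<eta> t"
    and upper: "\<forall>\<^sub>F t in at_top. \<eta> t \<le> \<phi> (t + 1) + K * t"
  shows "\<exists>C'. \<forall>\<^sub>F t in at_top. (\<eta> (t + 1) - \<eta> t) / (\<eta> t - \<eta> (t - 1)) \<le> C'"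
proof -
  define D where "D = max 0 C"
  define N where "N = \<bar>K\<bar>"
  define \<Delta> where "\<Delta> t = \<phi> t - \<phi> (t - 1)" for t
  have "\<forall>\<^sub>F t in at_top. 0 < t \<and> 8 * (N + 1) * t \<le> \<Delta> t \<and> \<Delta> (t + 1) \<le> D * \<Delta> t
      \<and> \<phi> (t - 1) - N * t \<le> \<eta> t \<and> \<eta> t \<le> \<phi> (t + 1) + N * t"
    using superquadratic_growth_increment[OF sq conv, of "8 * (N + 1)"] C lower upper
      eventually_gt_at_top[of 0]
  proof eventually_elim
    case (elim t)
    have "0 \<le> N" by (simp add: N_def)
    then have pos: "0 < \<Delta> t" using elim
      by (smt (verit) \<Delta>_def mult_pos_pos)
    have "\<Delta> (t + 1) \<le> C * \<Delta> t" using elim(2) pos by (simp add: \<Delta>_def pos_divide_le_eq)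
    also have "\<dots> \<le> D * \<Delta> t" using pos by (intro mult_right_mono) (auto simp: D_def)
    finally have "\<Delta> (t + 1) \<le> D * \<Delta> t" .
    moreover have "K * t \<le> N * t" using elim by (intro mult_right_mono) (auto simp: N_def)
    ultimately show ?case using elim unfolding \<Delta>_def by linarith
  qed
  then obtain T where T: "\<And>t. t \<ge> T \<Longrightarrow> 0 < t \<and> 8 * (N + 1) * t \<le> \<Delta> t \<and> \<Delta> (t + 1) \<le> D * \<Delta> t
      \<and> \<phi> (t - 1) - N * t \<le> \<eta> t \<and> \<eta> t \<le> \<phi> (t + 1) + N * t"
    unfolding eventually_at_top_linorder by blast
  have "D \<ge> 0" "N \<ge> 0" by (auto simp: D_def N_def)
  have "(\<eta> (t + 1) - \<eta> t) / (\<eta> t - \<eta> (t - 1)) \<le> 8 * (D ^ 4 + D ^ 3 + D ^ 2 + 1)"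
    if t: "t \<ge> T + 4" for t
  proof -
    define d where "d = \<Delta> (t - 2)"
    have "0 < t" using T[of t] t by simp
    have "0 < T" using T[of T] by simp
    have d_ge: "8 * (N + 1) * (t - 2) \<le> d" using T[of "t - 2"] t by (simp add: d_def)
    \<comment> \<open>As t > 4, the constant 8 gives d \<ge> 4 (N + 1) t, so the linear errors in
      the denominator take at most half of d.\<close>
    have "(N + 1) * (2 * t) \<le> (N + 1) * (4 * (t - 2))"
      using t \<open>0 < T\<close> \<open>N \<ge> 0\<close> by (intro mult_left_mono) auto
    then have d: "2 * (N + 1) * t \<le> d / 2" using d_ge by (simp add: algebra_simps)
    have "0 < 2 * (N + 1) * t" using \<open>0 < t\<close> \<open>N \<ge> 0\<close> by simp
    then have "0 < d" using d by linarith
    have step: "\<Delta> (x + 1) \<le> D * \<Delta> x" if "x \<ge> T" for x using T[OF that] by simp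
    have s1: "\<Delta> (t - 1) \<le> D * d" using step[of "t - 2"] t by (simp add: d_def)
    have "D * \<Delta> (t - 1) \<le> D * (D * d)" using s1 \<open>D \<ge> 0\<close> by (intro mult_left_mono)
    then have s2: "\<Delta> t \<le> D ^ 2 * d" using step[of "t - 1"] t by (simp add: power2_eq_square)
    have "D * \<Delta> t \<le> D * (D ^ 2 * d)" using s2 \<open>D \<ge> 0\<close> by (intro mult_left_mono)
    then have s3: "\<Delta> (t + 1) \<le> D ^ 3 * d" using step[of t] t by (simp add: power_numeral_reduce)
    have "D * \<Delta> (t + 1) \<le> D * (D ^ 3 * d)" using s3 \<open>D \<ge> 0\<close> by (intro mult_left_mono)
    then have s4: "\<Delta> (t + 2) \<le> D ^ 4 * d"
      using step[of "t + 1"] t by (simp add: power_numeral_reduce add.assoc)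
    have Nt: "N * (t + 1) + N * t \<le> d"
      using d t \<open>0 < T\<close> \<open>N \<ge> 0\<close> mult_left_mono[of 1 t N] by (simp add: algebra_simps)
    have "\<eta> (t + 1) - \<eta> t \<le> (\<phi> (t + 2) + N * (t + 1)) - (\<phi> (t - 1) - N * t)"
      using T[of t] T[of "t + 1"] t by (simp add: add.assoc)
    also have "\<dots> = \<Delta> (t + 2) + \<Delta> (t + 1) + \<Delta> t + (N * (t + 1) + N * t)"
      by (simp add: \<Delta>_def add.commute)
    also have "\<dots> \<le> D ^ 4 * d + D ^ 3 * d + D ^ 2 * d + d"
      using s2 s3 s4 Nt by linarith
    finally have num: "\<eta> (t + 1) - \<eta> t \<le> (D ^ 4 + D ^ 3 + D ^ 2 + 1) * d"
      by (simp add: algebra_simps)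
    \<comment> \<open>The unit shifts at both ends would eat up a chord of length 2. Length 4 leaves
      a rise of at least d - d/2, whence slope at least d / 8.\<close>
    have "(\<eta> t - \<eta> (t - 4)) / (t - (t - 4)) \<le> (\<eta> t - \<eta> (t - 1)) / (t - (t - 1))"
      by (intro convex_slope_mono[OF conv']) auto
    moreover have "\<eta> t - \<eta> (t - 4) \<ge> (\<phi> (t - 1) - N * t) - (\<phi> (t - 3) + N * (t - 4))"
      using T[of t] T[of "t - 4"] t by simp
    moreover have "\<phi> (t - 2) \<le> \<phi> (t - 1)"
    proof -
      have "0 \<le> 8 * (N + 1) * (t - 1)" using t \<open>0 < T\<close> \<open>N \<ge> 0\<close> by simp
      then show ?thesis using T[of "t - 1"] t unfolding \<Delta>_def by simp
    qed
    moreover have "N * t + N * (t - 4) \<le> d / 2"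
      using d \<open>N \<ge> 0\<close> \<open>0 < t\<close> by (simp add: algebra_simps)
    ultimately have den: "d / 8 \<le> \<eta> t - \<eta> (t - 1)"
      by (simp add: d_def \<Delta>_def)
    have "(\<eta> (t + 1) - \<eta> t) / (\<eta> t - \<eta> (t - 1)) \<le> ((D ^ 4 + D ^ 3 + D ^ 2 + 1) * d) / (d / 8)"
      using num den \<open>0 < d\<close> \<open>D \<ge> 0\<close> by (intro frac_le) auto
    also have "\<dots> = 8 * (D ^ 4 + D ^ 3 + D ^ 2 + 1)" using \<open>0 < d\<close> by simp
    finally show ?thesis .
  qed
  then show ?thesis unfolding eventually_at_top_linorder by blast
qed

section \<open>Compositions\<close>

lemma Limsup_ereal_less_PInf_iff:
  "Limsup F (\<lambda>t. ereal (h t)) < \<infinity> \<longleftrightarrow> (\<exists>B. \<forall>\<^sub>F t in F. h t \<le> B)"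
proof
  assume "Limsup F (\<lambda>t. ereal (h t)) < \<infinity>"
  then obtain n :: nat where "Limsup F (\<lambda>t. ereal (h t)) < ereal (real n)"
    using less_PInf_Ex_of_nat by auto
  then have "\<forall>\<^sub>F t in F. ereal (h t) < ereal (real n)" by (rule Limsup_lessD)
  then have "\<forall>\<^sub>F t in F. h t \<le> real n" by eventually_elim simp
  then show "\<exists>B. \<forall>\<^sub>F t in F. h t \<le> B" ..
next
  assume "\<exists>B. \<forall>\<^sub>F t in F. h t \<le> B"
  then obtain B where "\<forall>\<^sub>F t in F. ereal (h t) \<le> ereal B" by auto
  then have "Limsup F (\<lambda>t. ereal (h t)) \<le> ereal B" by (rule Limsup_bounded)
  also have "\<dots> < \<infinity>" by simp
  finally show "Limsup F (\<lambda>t. ereal (h t)) < \<infinity>" .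
qed

lemma growth_order_finite_iff:
  "growth_order f < \<infinity> \<longleftrightarrow> (\<exists>B. \<forall>\<^sub>F t in at_top. ln (phi f t) \<le> B * t)"
  unfolding growth_order_def Limsup_ereal_less_PInf_iff
proof (intro ex_cong1 iffI)
  fix B
  assume "\<forall>\<^sub>F r in at_top. ln (log_max_modulus f r) / ln r \<le> B"
  from eventually_compose_filterlim[OF this exp_at_top] eventually_gt_at_top[of 0]
  show "\<forall>\<^sub>F t in at_top. ln (phi f t) \<le> B * t"
    by eventually_elim (simp add: phi_def pos_divide_le_eq)
next
  fix B
  assume "\<forall>\<^sub>F t in at_top. ln (phi f t) \<le> B * t"
  from eventually_compose_filterlim[OF this ln_at_top] eventually_gt_at_top[of 1]
  show "\<forall>\<^sub>F r in at_top. ln (log_max_modulus f r) / ln r \<le> B"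
    by eventually_elim (simp add: phi_def pos_divide_le_eq)
qed

lemma superquadratic_iff: "superquadratic f \<longleftrightarrow> superquadratic_growth (phi f)"
  by (simp add: superquadratic_def superquadratic_growth_def)

lemma superquadratic_nonzero:
  fixes f :: "complex ^ 'n \<Rightarrow> complex"
  assumes "entire_fun f" "superquadratic f"
  obtains z0 where "f z0 \<noteq> 0"
proof (rule ccontr)
  assume "\<not> thesis"
  with that have zero: "f z = 0" for z by blast
  \<comment> \<open>The default value ln 0 = 0 makes \<open>phi\<close> of the zero function vanish,
    so superquadratic growth excludes it.\<close>
  have "phi f t = 0" for t
  proof -
    have "max_modulus f (exp t) \<le> 0" by (intro max_modulus_le) (auto simp: zero)
    then have "max_modulus f (exp t) = 0"
      using max_modulus_nonneg[OF assms(1), of "exp t"] by simp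
    then show ?thesis by (simp add: phi_def log_max_modulus_def)
  qed
  then have "\<forall>\<^sub>F t::real in at_top. 1 * t\<^sup>2 \<le> 0"
    using superquadratic_growth_ge[of "phi f" 1] assms(2) by (simp add: superquadratic_iff)
  then have "\<forall>\<^sub>F t::real in at_top. t \<noteq> t"
    using eventually_gt_at_top[of 0] by eventually_elim simp
  then show False by simp
qed

text \<open>For a polynomial the modulus is at most a constant times a power of the radius, so
  \<open>phi f\<close> grows at most linearly.\<close>

lemma superquadratic_not_polynomial:
  fixes f :: "complex ^ 'n \<Rightarrow> complex"
  assumes f: "entire_fun f" and sq: "superquadratic f"
  shows "\<not> polynomial_fun f"
proof
  obtain z0 where z0: "f z0 \<noteq> 0" using superquadratic_nonzero[OF f sq] .
  assume "polynomial_fun f"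
  then obtain A :: "('n \<Rightarrow> nat) set" and c where "finite A"
    and fz: "\<And>z. f z = (\<Sum>\<alpha>\<in>A. c \<alpha> * (\<Prod>i\<in>UNIV. (z $ i) ^ \<alpha> i))"
    unfolding polynomial_fun_def by blast
  \<comment> \<open>Summing all exponents of all monomials gives a crude bound for every degree; the
    summand 1 in K keeps ln K a genuine logarithm.\<close>
  define N where "N = (\<Sum>\<alpha>\<in>A. \<Sum>i\<in>UNIV. \<alpha> i)"
  define K where "K = 1 + (\<Sum>\<alpha>\<in>A. norm (c \<alpha>))"
  have "0 < K" by (simp add: K_def add_pos_nonneg sum_nonneg)
  have "phi f t \<le> ln K + real N * t" if "t \<ge> 0" for t
  proof (rule phi_le[OF f z0])
    fix z :: "complex ^ 'n" assume z: "norm z < exp t"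
    have "norm (f z) \<le> (\<Sum>\<alpha>\<in>A. norm (c \<alpha> * (\<Prod>i\<in>UNIV. (z $ i) ^ \<alpha> i)))"
      unfolding fz by (rule norm_sum)
    also have "\<dots> \<le> (\<Sum>\<alpha>\<in>A. norm (c \<alpha>) * exp t ^ N)"
    proof (rule sum_mono)
      fix \<alpha> assume "\<alpha> \<in> A"
      have "norm (\<Prod>i\<in>UNIV. (z $ i) ^ \<alpha> i) = (\<Prod>i\<in>UNIV. norm (z $ i) ^ \<alpha> i)"
        by (simp add: norm_power flip: prod_norm)
      also have "\<dots> \<le> (\<Prod>i\<in>UNIV. exp t ^ \<alpha> i)"
        using z Finite_Cartesian_Product.norm_nth_le[of z]
        by (intro prod_mono conjI power_mono) (auto intro: order_trans less_imp_le)
      also have "\<dots> = exp t ^ (\<Sum>i\<in>UNIV. \<alpha> i)" by (simp add: power_sum)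
      also have "\<dots> \<le> exp t ^ N"
        unfolding N_def using that \<open>finite A\<close> \<open>\<alpha> \<in> A\<close>
        by (intro power_increasing member_le_sum) auto
      finally show "norm (c \<alpha> * (\<Prod>i\<in>UNIV. (z $ i) ^ \<alpha> i)) \<le> norm (c \<alpha>) * exp t ^ N"
        by (simp add: norm_mult mult_left_mono)
    qed
    also have "\<dots> \<le> K * exp t ^ N" by (simp add: K_def sum_distrib_right distrib_right)
    also have "\<dots> = exp (ln K + real N * t)"
      using \<open>0 < K\<close> by (simp add: exp_add exp_of_nat_mult)
    finally show "norm (f z) \<le> exp (ln K + real N * t)" .
  qed
  then have "\<forall>\<^sub>F t in at_top. phi f t \<le> ln K + real N * t"
    by (rule eventually_mono[OF eventually_ge_at_top[of 0]])
  then have "\<forall>\<^sub>F t::real in at_top. t \<noteq> t"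
    using superquadratic_growth_ge[OF sq[unfolded superquadratic_iff], of "\<bar>ln K\<bar> + N + 1"]
      eventually_ge_at_top[of 1]
  proof eventually_elim
    case (elim t)
    have "1 * t \<le> t * t" using elim by (intro mult_right_mono) auto
    then have t: "t \<le> t\<^sup>2" "1 \<le> t\<^sup>2" using elim unfolding power2_eq_square by linarith+
    have "ln K \<le> \<bar>ln K\<bar> * t\<^sup>2" using t mult_left_mono[of 1 "t\<^sup>2" "\<bar>ln K\<bar>"] by simp
    moreover have "real N * t \<le> real N * t\<^sup>2" using t by (intro mult_left_mono) auto
    ultimately have False using elim t unfolding distrib_right by linarith
    then show ?case ..
  qed
  then show False by simp
qed

lemma class_C_slow_secants:
  fixes f :: "complex ^ 'n \<Rightarrow> complex"
  assumes "f \<in> class_C" and sq: "superquadratic f"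
  shows "slow_secants (phi f)"
proof -
  have f: "entire_fun f" using assms(1) by (simp add: class_C_def)
  obtain z0 where z0: "f z0 \<noteq> 0" using superquadratic_nonzero[OF f sq] .
  note sq' = sq[unfolded superquadratic_iff]
  note lim = superquadratic_growth_at_top[OF sq']
  consider "finite_order_cond f" | "infinite_order_cond f"
    using assms(1) by (auto simp: class_C_def)
  then show ?thesis
  proof cases
    case 1
    then show ?thesis
      unfolding finite_order_cond_def Limsup_ereal_less_PInf_iff
      using slow_secants_if_increments_bounded[OF sq' convex_on_phi[OF f z0]] by blast
  next
    case 2
    then obtain \<psi> where \<psi>: "convex_on UNIV \<psi>" "mono \<psi>"
      "((\<lambda>t. ln (\<psi> t) / ln (phi f t)) \<longlongrightarrow> 1) at_top"
      "((\<lambda>t. t\<^sup>2 * deriv (\<lambda>s. 1 / ln (\<psi> s)) t) \<longlongrightarrow> 0)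
         (inf at_top (principal {t. \<psi> differentiable (at t)}))"
      by (auto simp: infinite_order_cond_def)
    \<comment> \<open>Exponent 1 + \<delta> = 3/2 means \<delta> = 1/2, and then \<delta> / 8 =
      1/16.\<close>
    show ?thesis
      using slow_secants_if_le_powr[OF lim, of "1 / 16"]
        eventually_le_powr_if_ln_regular[OF lim \<psi>, of "1 / 2"] by simp
  qed
qed

text \<open>The Borel--Caratheodory inequality on the ball of radius \<open>exp t\<close>, applied along the complex
  line through \<open>z\<close>, recovers the size of \<open>f\<close> from the real part of a rotation of \<open>f\<close>.\<close>

lemma phi_shift_le_ln_if_Re_le:
  fixes f :: "complex ^ 'n \<Rightarrow> complex"
  assumes f: "entire_fun f" and z0: "f z0 \<noteq> 0" and c: "norm c = 1" and s: "0 < s" "s \<le> 1"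
    and "0 \<le> Y" and Re: "\<And>z. norm z < exp t \<Longrightarrow> Re (c * f z) \<le> Y"
  shows "phi f (t - s) \<le> ln (3 * (Y + 1 + norm (f 0)) / s)"
proof (rule phi_le[OF f z0])
  fix z :: "complex ^ 'n" assume z: "norm z < exp (t - s)"
  \<comment> \<open>The value at 0 enters because Borel--Caratheodory bounds Re (h w - h 0); the 1
    makes that bound strict and \<beta> positive.\<close>
  define \<beta> where "\<beta> = Y + 1 + norm (f 0)"
  have "0 < \<beta>" using \<open>0 \<le> Y\<close> by (simp add: \<beta>_def add_pos_nonneg)
  have "norm (f z) \<le> 3 * \<beta> / s"
  proof (cases "z = 0")
    case True
    have "1 * norm (f 0) \<le> (3 / s) * \<beta>"
      using s \<open>0 \<le> Y\<close> by (intro mult_mono) (auto simp: \<beta>_def)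
    then show ?thesis using True by simp
  next
    case False
    define r where "r = norm z"
    have r: "0 < r" using False by (simp add: r_def)
    define v where "v = inverse (of_real r) *s z"
    have v: "norm v = 1" using r by (simp add: v_def norm_vector_smult norm_inverse flip: r_def)
    have zv: "of_real r *s v = z" using r by (simp add: v_def vec_eq_iff)
    \<comment> \<open>The gap exp t - r is at least r s, so the radius cancels and 2 \<beta> / s is
      left. The value at 0 adds at most \<beta> / s, which explains the factor 3.\<close>
    have "r * (1 + s) \<le> r * exp s" using r exp_ge_add_one_self[of s] by (simp add: mult_left_mono)
    also have "\<dots> \<le> exp (t - s) * exp s" using z by (intro mult_right_mono) (auto simp: r_def)
    also have "\<dots> = exp t" by (simp flip: exp_add)
    finally have rs: "r * s \<le> exp t - r" by (simp add: algebra_simps)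
    have "0 < r * s" using r s by simp
    define h where "h w = c * f (w *s v)" for w
    have "norm (h (of_real r) - h 0) * (exp t - norm (of_real r :: complex)) \<le> 2 * \<beta> * norm (of_real r :: complex)"
    proof (rule borel_caratheodory[OF _ _ \<open>0 < \<beta>\<close>])
      show "h holomorphic_on UNIV"
        unfolding h_def by (intro holomorphic_intros entire_fun_on_line[OF f])
      show "Re (h w - h 0) < \<beta>" if "norm w < exp t" for w
      proof -
        have "Re (h w) \<le> Y" unfolding h_def using that by (intro Re) (simp add: norm_vector_smult v)
        moreover have "- Re (h 0) \<le> norm (f 0)"
          using abs_Re_le_cmod[of "h 0"] c by (simp add: h_def norm_mult)
        ultimately show ?thesis by (simp add: \<beta>_def)
      qed
      show "norm (of_real r :: complex) < exp t"
        using rs \<open>0 < r * s\<close> r by simp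
    qed simp
    then have "norm (h (of_real r) - h 0) * (exp t - r) \<le> 2 * \<beta> * r" using r by simp
    moreover have "norm (h (of_real r) - h 0) * (r * s) \<le> norm (h (of_real r) - h 0) * (exp t - r)"
      using rs by (intro mult_left_mono) auto
    ultimately have "r * (norm (h (of_real r) - h 0) * s) \<le> r * (2 * \<beta>)"
      by (simp add: algebra_simps)
    then have "norm (h (of_real r) - h 0) * s \<le> 2 * \<beta>" using r by (simp only: mult_le_cancel_left_pos)
    then have "norm (h (of_real r) - h 0) \<le> 2 * \<beta> / s" using s by (simp add: pos_le_divide_eq)
    moreover have "norm (h (of_real r) - h 0) = norm (f z - f 0)"
      using c by (simp add: h_def zv norm_mult flip: right_diff_distrib)
    moreover have "norm (f z) \<le> norm (f z - f 0) + norm (f 0)"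
      by (metis diff_add_cancel norm_triangle_ineq)
    moreover have "1 * norm (f 0) \<le> (1 / s) * \<beta>"
      using s \<open>0 \<le> Y\<close> by (intro mult_mono) (auto simp: \<beta>_def)
    then have "norm (f 0) \<le> \<beta> / s" by simp
    moreover have "3 * \<beta> / s = 2 * \<beta> / s + \<beta> / s" by (simp add: add_divide_distrib)
    ultimately show ?thesis by linarith
  qed
  also have "\<dots> = exp (ln (3 * \<beta> / s))" using \<open>0 < \<beta>\<close> s by simp
  finally show "norm (f z) \<le> exp (ln (3 * (Y + 1 + norm (f 0)) / s))" by (simp add: \<beta>_def)
qed

text \<open>The two pointwise bounds treat exp, sin and cos at once. The unimodular c selects the
  direction of exponential growth: 1 for exp, and -\<i> for sin and cos because Re (-\<i> w) = Im w.
  The 2 and the + 1 allow for the denominator and for the smaller of the two exponentials.\<close>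

lemma class_C_exponential_type_composition:
  fixes f g :: "complex ^ 'n \<Rightarrow> complex"
  assumes "f \<in> class_C" and sq: "superquadratic f" and g: "entire_fun g" and c: "norm c = 1"
    and upper: "\<And>z. norm (g z) \<le> exp (norm (f z))"
    and lower: "\<And>z. exp (Re (c * f z)) \<le> 2 * norm (g z) + 1"
  shows "g \<in> class_C"
proof -
  have f: "entire_fun f" using assms(1) by (simp add: class_C_def)
  obtain z0 where z0: "f z0 \<noteq> 0" using superquadratic_nonzero[OF f sq] .
  note sq' = sq[unfolded superquadratic_iff]
  note lim = superquadratic_growth_at_top[OF sq']
  note conv = convex_on_phi[OF f z0] and mono = mono_phi[OF f z0]
  note slow = class_C_slow_secants[OF assms(1,2)]
  have lower': "phi f (t - s) \<le> ln (3 * (max (phi g t) 0 + 3 + norm (f 0)) / s)"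
    if s: "0 < s" "s \<le> 1" for t s
  proof -
    \<comment> \<open>The maximum with 0 also covers a vanishing maximum modulus, as g has not yet
      been shown to be nonzero.\<close>
    define Y where "Y = max (phi g t) 0"
    have M: "max_modulus g (exp t) \<le> exp Y"
    proof (cases "max_modulus g (exp t) = 0")
      case False
      then have "exp (phi g t) = max_modulus g (exp t)"
        using max_modulus_nonneg[OF g, of "exp t"] by (simp add: phi_def log_max_modulus_def)
      then show ?thesis by (simp add: Y_def flip: \<open>exp (phi g t) = _\<close>)
    qed simp
    have Re: "Re (c * f z) \<le> Y + 2" if "norm z < exp t" for z
    proof -
      have "exp (Re (c * f z)) \<le> 2 * exp Y + 1"
        using lower[of z] M norm_le_max_modulus_ball[OF g that] by linarith
      also have "\<dots> \<le> 3 * exp Y" by (simp add: Y_def)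
      also have "\<dots> \<le> exp 2 * exp Y"
        using exp_ge_add_one_self[of 2] by (intro mult_right_mono) auto
      also have "\<dots> = exp (Y + 2)" by (simp add: exp_add)
      finally show ?thesis by simp
    qed
    have "0 \<le> Y + 2" by (simp add: Y_def)
    from phi_shift_le_ln_if_Re_le[OF f z0 c s this Re]
    show ?thesis by (simp add: Y_def add.assoc)
  qed
  define \<eta> where "\<eta> = phi g"
  define C where "C = 3 + norm (f 0)"
  \<comment> \<open>The 3 collects the loss 1 of the backward shift and ln 3 \<le> 2; passing from 3
    to 4 pays for subtracting C.\<close>
  have "\<forall>\<^sub>F x::real in at_top. exp (x - 4 - 2 * ln x) \<le> exp (x - 3 - 2 * ln x) - C"
    by real_asymp
  note ev = eventually_compose_filterlim[OF this lim]
  have \<eta>_lower: "\<forall>\<^sub>F t in at_top. exp (phi f t - 4 - 2 * ln (phi f t)) \<le> \<eta> t"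
    using ev slow_secants_backward[OF slow conv lim]
      eventually_compose_filterlim[OF eventually_ge_at_top[of 1] lim]
  proof eventually_elim
    case (elim t)
    \<comment> \<open>This shift lowers \<open>phi f\<close> by at most 1, and 1/s contributes the
      term 2 ln (phi f t).\<close>
    define s where "s = 1 / (phi f t)\<^sup>2"
    define \<beta> where "\<beta> = max (\<eta> t) 0 + C"
    have "0 < \<beta>" by (simp add: \<beta>_def C_def add_nonneg_pos add_pos_nonneg)
    have s: "0 < s" "s \<le> 1" using elim by (auto simp: s_def)
    have "phi f t - 1 \<le> ln (3 * \<beta> / s)"
      using lower'[OF s, of t] elim(2) by (simp add: s_def \<beta>_def C_def \<eta>_def add.assoc)
    also have "3 * \<beta> / s = 3 * \<beta> * (phi f t)\<^sup>2" by (simp add: s_def)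
    also have "ln \<dots> = ln 3 + ln \<beta> + 2 * ln (phi f t)"
      using elim \<open>0 < \<beta>\<close> by (simp add: ln_mult ln_realpow)
    finally have "phi f t - 1 \<le> ln 3 + ln \<beta> + 2 * ln (phi f t)" .
    moreover have "ln 3 \<le> (2 :: real)" using ln_le_minus_one[of "3 :: real"] by simp
    ultimately have "phi f t - 3 - 2 * ln (phi f t) \<le> ln \<beta>" by linarith
    then have "exp (phi f t - 3 - 2 * ln (phi f t)) \<le> \<beta>" using \<open>0 < \<beta>\<close> by (simp add: ln_ge_iff)
    with elim(1) have "exp (phi f t - 4 - 2 * ln (phi f t)) \<le> max (\<eta> t) 0"
      by (simp add: \<beta>_def)
    moreover have "0 < exp (phi f t - 4 - 2 * ln (phi f t))" by simp
    ultimately show ?case by linarith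
  qed
  have \<eta>_upper: "\<forall>\<^sub>F t in at_top. \<eta> t \<le> exp (phi f t)"
  proof (rule always_eventually, rule allI)
    fix t
    show "\<eta> t \<le> exp (phi f t)"
    proof (cases "max_modulus g (exp t) = 0")
      case False
      then have pos: "0 < max_modulus g (exp t)"
        using max_modulus_nonneg[OF g, of "exp t"] by simp
      have "max_modulus g (exp t) \<le> exp (exp (phi f t))"
      proof (rule max_modulus_le)
        fix z :: "complex ^ 'n" assume "norm z < exp t"
        then have "norm (f z) \<le> exp (phi f t)" by (intro norm_le_exp_phi[OF f z0]) simp
        then show "norm (g z) \<le> exp (exp (phi f t))" using upper[of z] by (smt (verit) exp_le_cancel_iff)
      qed simp
      then have "ln (max_modulus g (exp t)) \<le> ln (exp (exp (phi f t)))"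
        using pos by (intro ln_mono) auto
      then show ?thesis by (simp add: \<eta>_def phi_def[of g] log_max_modulus_def)
    qed (simp add: \<eta>_def phi_def[of g] log_max_modulus_def)
  qed
  have lim_lower: "((\<lambda>t. (phi f t - 4 - 2 * ln (phi f t)) / phi f t) \<longlongrightarrow> 1) at_top"
    by (rule filterlim_compose[OF _ lim]) real_asymp
  have le1: "\<forall>\<^sub>F t in at_top. (phi f t - 4 - 2 * ln (phi f t)) / phi f t \<le> ln (\<eta> t) / phi f t"
    using \<eta>_lower eventually_compose_filterlim[OF eventually_gt_at_top[of 0] lim]
  proof eventually_elim
    case (elim t)
    have "0 < \<eta> t" using elim(1) by (smt (verit) exp_gt_zero)
    then have "phi f t - 4 - 2 * ln (phi f t) \<le> ln (\<eta> t)" using elim(1) by (simp add: ln_ge_iff)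
    then show ?case using elim by (intro divide_right_mono) auto
  qed
  have le2: "\<forall>\<^sub>F t in at_top. ln (\<eta> t) / phi f t \<le> 1"
    using \<eta>_lower \<eta>_upper eventually_compose_filterlim[OF eventually_gt_at_top[of 0] lim]
  proof eventually_elim
    case (elim t)
    have "0 < \<eta> t" using elim(1) by (smt (verit) exp_gt_zero)
    then have "ln (\<eta> t) \<le> phi f t" using elim(2) by (metis ln_exp ln_mono)
    then show ?case using elim by simp
  qed
  have ratio: "((\<lambda>t. ln (\<eta> t) / phi f t) \<longlongrightarrow> 1) at_top"
    by (rule tendsto_sandwich[OF le1 le2 lim_lower tendsto_const])
  have half: "\<forall>\<^sub>F t in at_top. phi f t / 2 \<le> ln (\<eta> t)"
  proof -
    have "\<forall>\<^sub>F t in at_top. 1 / 2 < ln (\<eta> t) / phi f t"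
      by (rule order_tendstoD(1)[OF ratio]) simp
    with eventually_compose_filterlim[OF eventually_gt_at_top[of 0] lim] show ?thesis
      by eventually_elim (simp add: field_simps)
  qed
  \<comment> \<open>Finite order would mean ln (phi g t) = O(t), but it is at least half of
    \<open>phi f t\<close>, hence of t^2.\<close>
  have "\<not> growth_order g < \<infinity>"
  proof
    assume "growth_order g < \<infinity>"
    then obtain B where "\<forall>\<^sub>F t in at_top. ln (\<eta> t) \<le> B * t"
      unfolding growth_order_finite_iff \<eta>_def by blast
    then have "\<forall>\<^sub>F t::real in at_top. t \<noteq> t"
      using half superquadratic_growth_ge[OF sq', of 1]
        eventually_gt_at_top[of "max 0 (2 * B)"]
    proof eventually_elim
      case (elim t)
      have "2 * B * t < t * t" using elim by (intro mult_strict_right_mono) auto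
      then show ?case using elim by (simp add: power2_eq_square)
    qed
    then show False by simp
  qed
  then have "growth_order g = \<infinity>" by simp
  moreover have "convex_on UNIV (\<lambda>t. exp (phi f t))"
  proof (rule convex_onI)
    fix u x y :: real assume u: "0 < u" "u < 1"
    have "phi f ((1 - u) *\<^sub>R x + u *\<^sub>R y) \<le> (1 - u) * phi f x + u * phi f y"
      using u by (intro convex_onD[OF conv]) auto
    then have "exp (phi f ((1 - u) *\<^sub>R x + u *\<^sub>R y)) \<le> exp ((1 - u) *\<^sub>R phi f x + u *\<^sub>R phi f y)"
      by simp
    also have "\<dots> \<le> (1 - u) * exp (phi f x) + u * exp (phi f y)"
      using u by (intro convex_onD[OF exp_convex]) auto
    finally show "exp (phi f ((1 - u) *\<^sub>R x + u *\<^sub>R y)) \<le> (1 - u) * exp (phi f x) + u * exp (phi f y)" .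
  qed simp
  moreover have "mono (\<lambda>t. exp (phi f t))" using mono by (simp add: mono_def)
  moreover have "continuous_on UNIV (\<lambda>t. exp (phi f t))"
    using convex_on_continuous[OF open_UNIV conv] by (rule continuous_on_exp)
  moreover have "((\<lambda>t. ln (exp (phi f t)) / ln (phi g t)) \<longlongrightarrow> 1) at_top"
    using tendsto_inverse[OF ratio] by (simp add: \<eta>_def)
  moreover have "((\<lambda>t. t\<^sup>2 * deriv (\<lambda>s. 1 / ln (exp (phi f s))) t) \<longlongrightarrow> 0)
      (inf at_top (principal {t. (\<lambda>t. exp (phi f t)) differentiable (at t)}))"
  proof -
    \<comment> \<open>The limit must be taken along the differentiability points of \<psi> = exp
      \<phi>; composing with ln shows that \<phi> is differentiable there too.\<close>
    have "phi f differentiable (at t)" if diff: "(\<lambda>t. exp (phi f t)) differentiable (at t)" for t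
    proof -
      obtain d where "((\<lambda>t. exp (phi f t)) has_real_derivative d) (at t)"
        using diff unfolding real_differentiable_def by blast
      then have "((\<lambda>t. ln (exp (phi f t))) has_real_derivative 1 / exp (phi f t) * d) (at t)"
        by (intro DERIV_ln_divide[THEN DERIV_chain2]) simp_all
      then show ?thesis using real_differentiable_def by auto
    qed
    then have "inf at_top (principal {t. (\<lambda>t. exp (phi f t)) differentiable (at t)})
        \<le> inf at_top (principal {t. phi f differentiable (at t)})"
      by (intro inf_mono) auto
    then show ?thesis
      using tendsto_mono[OF _ slow_secants_deriv_inverse[OF slow conv mono lim]] by simp
  qed
  ultimately have "infinite_order_cond g"
    unfolding infinite_order_cond_def by (intro conjI exI[of _ "\<lambda>t. exp (phi f t)"])
  moreover have "\<forall>\<^sub>F t in at_top. 1 / 2 * phi f t \<le> phi g t"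
    using half \<eta>_lower
  proof eventually_elim
    case (elim t)
    have "0 < \<eta> t" using elim(2) by (smt (verit) exp_gt_zero)
    then have "ln (\<eta> t) \<le> \<eta> t" using ln_le_minus_one[of "\<eta> t"] by simp
    then show ?case using elim by (simp add: \<eta>_def)
  qed
  then have "superquadratic g"
    unfolding superquadratic_iff by (intro superquadratic_growthI[OF sq', of "1 / 2"]) auto
  ultimately show ?thesis
    using g superquadratic_not_polynomial[OF g] by (simp add: class_C_def)
qed

section \<open>Derivatives and antiderivatives\<close>

text \<open>The type of f is inherited. Type (I) compares increments, so it rests on the bounds with
  unit shifts and linear error; in type (II) only ln (phi g) matters, and \<open>half\<close> and
  \<open>powr\<close> show it to be asymptotic to ln (phi f).\<close>

lemma class_C_transfer:
  fixes f g :: "complex ^ 'n \<Rightarrow> complex"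
  assumes "f \<in> class_C" and sq: "superquadratic f" and g: "entire_fun g"
    and lower: "\<forall>\<^sub>F t in at_top. phi f (t - 1) - K * t \<le> phi g t"
    and upper: "\<forall>\<^sub>F t in at_top. phi g t \<le> phi f (t + 1) + K * t"
    and half: "\<forall>\<^sub>F t in at_top. phi f t / 2 \<le> phi g t"
    and powr: "\<And>\<delta>. \<lbrakk>infinite_order_cond f; 0 < \<delta>; \<delta> \<le> 1\<rbrakk> \<Longrightarrow> \<forall>\<^sub>F t in at_top. phi g t \<le> phi f t powr (1 + \<delta>)"
  shows "g \<in> class_C \<and> superquadratic g"
proof -
  have f: "entire_fun f" using assms(1) by (simp add: class_C_def)
  obtain z0 where z0: "f z0 \<noteq> 0" using superquadratic_nonzero[OF f sq] .
  note sq' = sq[unfolded superquadratic_iff]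
  note lim = superquadratic_growth_at_top[OF sq']
  have sqg: "superquadratic g"
    unfolding superquadratic_iff using half by (intro superquadratic_growthI[OF sq', of "1 / 2"]) auto
  obtain z1 where z1: "g z1 \<noteq> 0" using superquadratic_nonzero[OF g sqg] .
  have pos: "\<forall>\<^sub>F t in at_top. 1 < phi f t" "\<forall>\<^sub>F t in at_top. 1 < phi g t"
    using lim superquadratic_growth_at_top[OF sqg[unfolded superquadratic_iff]]
    by (simp_all add: filterlim_at_top_dense)
  consider "finite_order_cond f" | "infinite_order_cond f"
    using assms(1) by (auto simp: class_C_def)
  then have "finite_order_cond g \<or> infinite_order_cond g"
  proof cases
    case 1
    obtain B where B: "\<forall>\<^sub>F t in at_top. ln (phi f t) \<le> B * t"
      using 1 unfolding finite_order_cond_def growth_order_finite_iff by blast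
    have shift: "filterlim (\<lambda>t::real. t + 1) at_top at_top" by real_asymp
    \<comment> \<open>The 2 comes from t + 1 \<le> 2 t, the 1 from t \<le> exp t in the linear
      error, and |K| from 1 + |K| \<le> exp (|K| t).\<close>
    have "\<forall>\<^sub>F t in at_top. ln (phi g t) \<le> (2 * \<bar>B\<bar> + 1 + \<bar>K\<bar>) * t"
      using eventually_compose_filterlim[OF B shift] eventually_compose_filterlim[OF pos(1) shift]
        pos(2) upper eventually_ge_at_top[of 1]
    proof eventually_elim
      case (elim t)
      have "B * (t + 1) \<le> \<bar>B\<bar> * (2 * t)" using elim by (intro mult_mono) auto
      then have "ln (phi f (t + 1)) \<le> \<bar>B\<bar> * (2 * t)" using elim by linarith
      then have "phi f (t + 1) \<le> exp (2 * \<bar>B\<bar> * t)"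
        using elim by (metis exp_le_cancel_iff exp_ln less_trans mult.assoc mult.left_commute zero_less_one)
      also have "\<dots> \<le> exp (2 * \<bar>B\<bar> * t) * exp t" using elim by simp
      finally have f_le: "phi f (t + 1) \<le> exp ((2 * \<bar>B\<bar> + 1) * t)"
        by (simp add: distrib_right exp_add)
      have "K * t \<le> \<bar>K\<bar> * exp t"
        using elim exp_ge_add_one_self[of t] by (intro mult_mono) (simp_all del: exp_ge_add_one_self)
      also have "\<dots> \<le> \<bar>K\<bar> * exp ((2 * \<bar>B\<bar> + 1) * t)"
        using elim by (intro mult_left_mono) (auto simp: distrib_right)
      finally have "phi g t \<le> (1 + \<bar>K\<bar>) * exp ((2 * \<bar>B\<bar> + 1) * t)"
        using f_le elim by (simp add: distrib_right)
      also have "\<dots> \<le> exp (\<bar>K\<bar> * t) * exp ((2 * \<bar>B\<bar> + 1) * t)"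
      proof (intro mult_right_mono)
        show "1 + \<bar>K\<bar> \<le> exp (\<bar>K\<bar> * t)"
          using exp_ge_add_one_self[of "\<bar>K\<bar> * t"] elim mult_left_mono[of 1 t "\<bar>K\<bar>"] by linarith
      qed simp
      also have "\<dots> = exp ((2 * \<bar>B\<bar> + 1 + \<bar>K\<bar>) * t)"
        by (simp add: algebra_simps flip: exp_add)
      finally show ?case using elim by (metis exp_ln exp_le_cancel_iff less_trans zero_less_one)
    qed
    then have "growth_order g < \<infinity>" unfolding growth_order_finite_iff by blast
    moreover obtain C where "\<forall>\<^sub>F t in at_top. (phi f (t + 1) - phi f t) / (phi f t - phi f (t - 1)) \<le> C"
      using 1 unfolding finite_order_cond_def Limsup_ereal_less_PInf_iff by blast
    from increments_bounded_transfer[OF sq' convex_on_phi[OF f z0] convex_on_phi[OF g z1] this lower upper]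
    have "Limsup at_top (\<lambda>t. ereal ((phi g (t + 1) - phi g t) / (phi g t - phi g (t - 1)))) < \<infinity>"
      unfolding Limsup_ereal_less_PInf_iff .
    ultimately show ?thesis by (simp add: finite_order_cond_def)
  next
    case 2
    then obtain \<psi> where \<psi>: "convex_on UNIV \<psi>" "mono \<psi>" "continuous_on UNIV \<psi>"
      "((\<lambda>t. ln (\<psi> t) / ln (phi f t)) \<longlongrightarrow> 1) at_top"
      "((\<lambda>t. t\<^sup>2 * deriv (\<lambda>s. 1 / ln (\<psi> s)) t) \<longlongrightarrow> 0)
         (inf at_top (principal {t. \<psi> differentiable (at t)}))"
      by (auto simp: infinite_order_cond_def)
    have "((\<lambda>t. ln (phi g t) / ln (phi f t)) \<longlongrightarrow> 1) at_top"
      using ln_ratio_tendsto_1[OF lim half powr[OF 2]] .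
    \<comment> \<open>Since the logarithms of \<open>phi f\<close> and \<open>phi g\<close> are
      asymptotic, the witness \<psi> of f serves for g unchanged.\<close>
    from tendsto_divide[OF \<psi>(4) this]
    have "((\<lambda>t. (ln (\<psi> t) / ln (phi f t)) / (ln (phi g t) / ln (phi f t))) \<longlongrightarrow> 1) at_top"
      by simp
    moreover have "\<forall>\<^sub>F t in at_top. (ln (\<psi> t) / ln (phi f t)) / (ln (phi g t) / ln (phi f t))
        = ln (\<psi> t) / ln (phi g t)"
      using pos(1) by eventually_elim simp
    ultimately have "((\<lambda>t. ln (\<psi> t) / ln (phi g t)) \<longlongrightarrow> 1) at_top"
      by (rule Lim_transform_eventually)
    moreover have "growth_order g = \<infinity>"
    proof (rule ccontr)
      assume "growth_order g \<noteq> \<infinity>"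
      then obtain B where "\<forall>\<^sub>F t in at_top. ln (phi g t) \<le> B * t"
        using growth_order_finite_iff[of g] by (auto simp: top.not_eq_extremum)
      with pos half eventually_ge_at_top[of 1]
      have "\<forall>\<^sub>F t in at_top. ln (phi f t) \<le> (B + 1) * t"
      proof eventually_elim
        case (elim t)
        have "ln (phi f t) \<le> ln (2 * phi g t)" using elim by (intro ln_mono) auto
        also have "\<dots> = ln 2 + ln (phi g t)" using elim by (simp add: ln_mult)
        also have "ln 2 \<le> (1 :: real)" using ln_le_minus_one[of "2 :: real"] by simp
        finally show ?case using elim by (simp add: distrib_right)
      qed
      then have "growth_order f < \<infinity>" unfolding growth_order_finite_iff by blast
      then show False using 2 by (simp add: infinite_order_cond_def)
    qed
    ultimately show ?thesis using \<psi> unfolding infinite_order_cond_def by blast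
  qed
  then show ?thesis
    using g sqg superquadratic_not_polynomial[OF g sqg] by (simp add: class_C_def)
qed

lemma norm_on_C1_le:
  assumes "on_C1 g z1 \<noteq> 0" "g holomorphic_on UNIV" "norm w \<le> exp t"
  shows "norm (g w) \<le> exp (phi (on_C1 g) t)"
  using norm_le_exp_phi[OF entire_fun_on_C1[OF assms(2)] assms(1), of "vec w" t] assms(3)
  by (simp add: on_C1_def norm_vec_def L2_set_def)

lemma phi_on_C1_le:
  assumes "on_C1 g z1 \<noteq> 0" "g holomorphic_on UNIV" "\<And>w. norm w < exp t \<Longrightarrow> norm (g w) \<le> exp B"
  shows "phi (on_C1 g) t \<le> B"
proof (rule phi_le[OF entire_fun_on_C1[OF assms(2)] assms(1)])
  show "norm (on_C1 g z) \<le> exp B" if "norm z < exp t" for z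
    unfolding on_C1_def using Finite_Cartesian_Product.norm_nth_le[of z 1] that
    by (intro assms(3)) linarith
qed

lemma norm_le_if_deriv_bounded:
  fixes F g :: "complex \<Rightarrow> complex"
  assumes F: "\<And>z. (F has_field_derivative g z) (at z)" and "\<And>w. norm w \<le> r \<Longrightarrow> norm (g w) \<le> B"
    and "norm z \<le> r"
  shows "norm (F z) \<le> norm (F 0) + r * B"
proof -
  have "0 \<le> r" using assms(3) norm_ge_zero[of z] by linarith
  have "0 \<le> B" using assms(2)[of 0] norm_ge_zero[of "g 0"] \<open>0 \<le> r\<close> by (simp del: norm_ge_zero)
  have "norm (F z - F 0) \<le> B * norm (z - 0)"
    by (rule field_differentiable_bound[of "cball 0 r" F g])
      (use assms \<open>0 \<le> r\<close> in \<open>auto intro: DERIV_subset\<close>)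
  also have "\<dots> \<le> B * r" using assms(3) \<open>0 \<le> B\<close> by (simp add: mult_left_mono)
  finally have "norm (F z - F 0) \<le> r * B" by (simp add: mult.commute)
  then show ?thesis using norm_triangle_ineq2[of "F z" "F 0"] by linarith
qed

section \<open>Mutual bounds for a function and its antiderivative\<close>

context
  fixes F g :: "complex \<Rightarrow> complex" and z0 z1
  assumes F: "\<And>z. (F has_field_derivative g z) (at z)"
    and nz: "on_C1 F z0 \<noteq> 0" "on_C1 g z1 \<noteq> 0"
begin

lemma antiderivative_holomorphic: "F holomorphic_on UNIV" "g holomorphic_on UNIV"
proof -
  show *: "F holomorphic_on UNIV"
    using F by (auto simp: holomorphic_on_def field_differentiable_def)
  have "deriv F = g" using F by (auto intro: DERIV_imp_deriv)
  then show "g holomorphic_on UNIV" using holomorphic_deriv[OF * open_UNIV] by simp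
qed

text \<open>Cauchy's estimate on the disc of radius s exp t about w, which stays within radius exp
  (t + s) because 1 + s \<le> exp s. The free s trades the size of the shift against the cost - ln
  s.\<close>

lemma phi_deriv_le:
  assumes "0 < s"
  shows "phi (on_C1 g) t \<le> phi (on_C1 F) (t + s) - t - ln s"
proof (rule phi_on_C1_le[OF nz(2) antiderivative_holomorphic(2)])
  fix w :: complex assume w: "norm w < exp t"
  define \<rho> where "\<rho> = exp t * s"
  have "0 < \<rho>" using assms by (simp add: \<rho>_def)
  have "exp t * (1 + s) \<le> exp t * exp s" by (intro mult_left_mono exp_ge_add_one_self) simp
  then have \<rho>: "exp t + \<rho> \<le> exp (t + s)" by (simp add: \<rho>_def exp_add distrib_left)
  have "norm ((deriv ^^ 1) F w) \<le> fact 1 * exp (phi (on_C1 F) (t + s)) / \<rho> ^ 1"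
  proof (rule Cauchy_inequality[OF _ _ \<open>0 < \<rho>\<close>])
    show "F holomorphic_on ball w \<rho>"
      using antiderivative_holomorphic(1) by (rule holomorphic_on_subset) simp
    show "continuous_on (cball w \<rho>) F"
      using antiderivative_holomorphic(1) holomorphic_on_imp_continuous_on holomorphic_on_subset by blast
    show "norm (F x) \<le> exp (phi (on_C1 F) (t + s))" if "norm (w - x) = \<rho>" for x
    proof (rule norm_on_C1_le[OF nz(1) antiderivative_holomorphic(1)])
      have "norm x \<le> norm w + norm (w - x)" using norm_triangle_sub[of x w] by (simp add: norm_minus_commute)
      then show "norm x \<le> exp (t + s)" using that w \<rho> by simp
    qed
  qed
  also have "(deriv ^^ 1) F w = g w" using F by (simp add: DERIV_imp_deriv)
  also have "fact 1 * exp (phi (on_C1 F) (t + s)) / \<rho> ^ 1 = exp (phi (on_C1 F) (t + s) - t - ln s)"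
    using assms by (simp add: \<rho>_def exp_diff)
  finally show "norm (g w) \<le> exp (phi (on_C1 F) (t + s) - t - ln s)" .
qed

text \<open>The mean value bound for F carries the constant \<open>norm (F 0)\<close>. Whichever
  function is superquadratic absorbs it at the price of a factor 2 \<le> exp 1, hence the + 1. The
  disjunction serves the passage in both directions.\<close>

lemma phi_antiderivative_le:
  assumes "superquadratic (on_C1 F) \<or> superquadratic (on_C1 g)"
  shows "\<forall>\<^sub>F t in at_top. phi (on_C1 F) t \<le> phi (on_C1 g) t + t + 1"
proof -
  have exp1: "2 \<le> exp (1 :: real)" using exp_ge_add_one_self[of 1] by simp
  have bound: "exp (phi (on_C1 F) t) \<le> norm (F 0) + exp (t + phi (on_C1 g) t)" for t
  proof -
    have "max_modulus (on_C1 F) (exp t) \<le> norm (F 0) + exp (t + phi (on_C1 g) t)"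
    proof (rule max_modulus_le)
      fix z :: "complex ^ 1" assume "norm z < exp t"
      then have "norm (z $ 1) \<le> exp t" using Finite_Cartesian_Product.norm_nth_le[of z 1] by linarith
      from norm_le_if_deriv_bounded[OF F norm_on_C1_le[OF nz(2) antiderivative_holomorphic(2)] this]
      show "norm (on_C1 F z) \<le> norm (F 0) + exp (t + phi (on_C1 g) t)"
        by (simp add: on_C1_def exp_add)
    qed simp
    then show ?thesis
      by (simp add: exp_phi[OF entire_fun_on_C1[OF antiderivative_holomorphic(1)] nz(1)])
  qed
  from assms show ?thesis
  proof
    assume "superquadratic (on_C1 F)"
    then have "filterlim (phi (on_C1 F)) at_top at_top"
      using superquadratic_growth_at_top superquadratic_iff by blast
    then have "\<forall>\<^sub>F t in at_top. ln (2 * norm (F 0) + 1) \<le> phi (on_C1 F) t"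
      by (simp add: filterlim_at_top)
    then show ?thesis
    proof eventually_elim
      case (elim t)
      have "0 < 2 * norm (F 0) + 1" by (simp add: add_nonneg_pos)
      then have "2 * norm (F 0) + 1 \<le> exp (phi (on_C1 F) t)"
        using elim by (simp flip: ln_le_cancel_iff)
      then have "exp (phi (on_C1 F) t) \<le> 2 * exp (t + phi (on_C1 g) t)" using bound[of t] by simp
      also have "\<dots> \<le> exp 1 * exp (t + phi (on_C1 g) t)" using exp1 by (intro mult_right_mono) auto
      finally show ?case by (simp add: algebra_simps flip: exp_add)
    qed
  next
    assume "superquadratic (on_C1 g)"
    then have "filterlim (phi (on_C1 g)) at_top at_top"
      using superquadratic_growth_at_top superquadratic_iff by blast
    then have "\<forall>\<^sub>F t in at_top. ln (norm (F 0) + 1) \<le> phi (on_C1 g) t"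
      by (simp add: filterlim_at_top)
    with eventually_ge_at_top[of 0] show ?thesis
    proof eventually_elim
      case (elim t)
      have "0 < norm (F 0) + 1" by (simp add: add_nonneg_pos)
      then have "norm (F 0) + 1 \<le> exp (t + phi (on_C1 g) t)"
        using elim by (simp flip: ln_le_cancel_iff)
      then have "exp (phi (on_C1 F) t) \<le> 2 * exp (t + phi (on_C1 g) t)" using bound[of t] by simp
      also have "\<dots> \<le> exp 1 * exp (t + phi (on_C1 g) t)" using exp1 by (intro mult_right_mono) auto
      finally show ?case by (simp add: algebra_simps flip: exp_add)
    qed
  qed
qed

lemma antiderivative_class_C:
  assumes C: "on_C1 g \<in> class_C" and sq: "superquadratic (on_C1 g)"
  shows "on_C1 F \<in> class_C \<and> superquadratic (on_C1 F)"
proof (rule class_C_transfer[OF C sq, where K = 2])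
  note sq' = sq[unfolded superquadratic_iff]
  note lim = superquadratic_growth_at_top[OF sq']
  note ent = entire_fun_on_C1[OF antiderivative_holomorphic(2)]
  note le = phi_antiderivative_le[OF disjI2[OF sq]]
  show "entire_fun (on_C1 F)" by (rule entire_fun_on_C1[OF antiderivative_holomorphic(1)])
  show "\<forall>\<^sub>F t in at_top. phi (on_C1 g) (t - 1) - 2 * t \<le> phi (on_C1 F) t"
    using eventually_ge_at_top[of 1]
  proof eventually_elim
    case (elim t)
    then show ?case using phi_deriv_le[of 1 "t - 1"] by simp
  qed
  show "\<forall>\<^sub>F t in at_top. phi (on_C1 F) t \<le> phi (on_C1 g) (t + 1) + 2 * t"
    using le eventually_ge_at_top[of 1]
  proof eventually_elim
    case (elim t)
    then show ?case using monoD[OF mono_phi[OF ent nz(2)], of t "t + 1"] by simp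
  qed
  have "\<forall>\<^sub>F x::real in at_top. x / 2 \<le> x - 1 - 2 * ln x" by real_asymp
  from eventually_compose_filterlim[OF this lim]
    slow_secants_backward[OF class_C_slow_secants[OF C sq] convex_on_phi[OF ent nz(2)] lim]
    eventually_compose_filterlim[OF eventually_ge_at_top[of 1] lim] eventually_ge_at_top[of 1]
  show "\<forall>\<^sub>F t in at_top. phi (on_C1 g) t / 2 \<le> phi (on_C1 F) t"
  proof eventually_elim
    case (elim t)
    \<comment> \<open>A unit shift could lose too much. This one costs at most 1 by slow secants and
      2 ln \<phi> by the Cauchy estimate, where \<phi> belongs to g, and half of \<phi>
      survives.\<close>
    define s where "s = 1 / (phi (on_C1 g) t)\<^sup>2"
    have s: "0 < s" "s \<le> 1" using elim by (auto simp: s_def)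
    have "ln s = - 2 * ln (phi (on_C1 g) t)" using elim by (simp add: s_def ln_div ln_realpow)
    then show ?case using phi_deriv_le[OF s(1), of "t - s"] elim s by (simp flip: s_def)
  qed
  fix \<delta> :: real assume \<delta>: "0 < \<delta>"
  then have "\<forall>\<^sub>F x::real in at_top. 2 * x + 1 \<le> x powr (1 + \<delta>)" by real_asymp
  from eventually_compose_filterlim[OF this lim] le superquadratic_growth_ge[OF sq', of 1]
    eventually_ge_at_top[of 1]
  show "\<forall>\<^sub>F t in at_top. phi (on_C1 F) t \<le> phi (on_C1 g) t powr (1 + \<delta>)"
  proof eventually_elim
    case (elim t)
    then show ?case using self_le_power[of t 2] by simp
  qed
qed

text \<open>The crux is the upper bound in type (II), which needs \<phi> to the right of t. There
  \<open>slow_secants\<close> gives control only at some unspecified s, so the regularity of \<psi>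
  is used directly: the shift 1 / \<phi> is eventually below c t^2 / ln \<phi> and costs only ln
  \<phi>.\<close>

lemma deriv_class_C:
  assumes C: "on_C1 F \<in> class_C" and sq: "superquadratic (on_C1 F)"
  shows "on_C1 g \<in> class_C \<and> superquadratic (on_C1 g)"
proof (rule class_C_transfer[OF C sq, where K = 2])
  note sq' = sq[unfolded superquadratic_iff]
  note lim = superquadratic_growth_at_top[OF sq']
  note mono = mono_phi[OF entire_fun_on_C1[OF antiderivative_holomorphic(1)] nz(1)]
  note le = phi_antiderivative_le[OF disjI1[OF sq]]
  show "entire_fun (on_C1 g)" by (rule entire_fun_on_C1[OF antiderivative_holomorphic(2)])
  show "\<forall>\<^sub>F t in at_top. phi (on_C1 F) (t - 1) - 2 * t \<le> phi (on_C1 g) t"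
    using le eventually_ge_at_top[of 1]
  proof eventually_elim
    case (elim t)
    then show ?case using monoD[OF mono, of "t - 1" t] by simp
  qed
  show "\<forall>\<^sub>F t in at_top. phi (on_C1 g) t \<le> phi (on_C1 F) (t + 1) + 2 * t"
    using eventually_ge_at_top[of 1]
  proof eventually_elim
    case (elim t)
    then show ?case using phi_deriv_le[of 1 t] by simp
  qed
  \<comment> \<open>The factor 4 gives t + 1 \<le> 2 t^2 \<le> \<phi> / 2 for \<phi> of F, so the
    error t + 1 takes at most half of \<phi>.\<close>
  show "\<forall>\<^sub>F t in at_top. phi (on_C1 F) t / 2 \<le> phi (on_C1 g) t"
    using le superquadratic_growth_ge[OF sq', of 4] eventually_ge_at_top[of 1]
  proof eventually_elim
    case (elim t)
    then show ?case using self_le_power[of t 2] by simp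
  qed
  fix \<delta> :: real assume inf: "infinite_order_cond (on_C1 F)" and \<delta>: "0 < \<delta>" "\<delta> \<le> 1"
  obtain \<psi> where \<psi>: "convex_on UNIV \<psi>" "mono \<psi>"
      "((\<lambda>t. ln (\<psi> t) / ln (phi (on_C1 F) t)) \<longlongrightarrow> 1) at_top"
      "((\<lambda>t. t\<^sup>2 * deriv (\<lambda>s. 1 / ln (\<psi> s)) t) \<longlongrightarrow> 0)
         (inf at_top (principal {t. \<psi> differentiable (at t)}))"
    using inf by (auto simp: infinite_order_cond_def)
  \<comment> \<open>Regularity is invoked with \<delta> / 2, leaving room for the term ln \<phi>
    below the power 1 + \<delta>.\<close>
  define c where "c = \<delta> / 2 / 8"
  have "0 < c" using \<delta> by (simp add: c_def)
  have reg: "\<forall>\<^sub>F t in at_top. phi (on_C1 F) (t + c * t\<^sup>2 / ln (phi (on_C1 F) t))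
      \<le> phi (on_C1 F) t powr (1 + \<delta> / 2)"
    unfolding c_def using \<delta> by (intro eventually_le_powr_if_ln_regular[OF lim \<psi>]) auto
  have "\<forall>\<^sub>F x::real in at_top. x powr (1 + \<delta> / 2) + ln x \<le> x powr (1 + \<delta>)"
    using \<delta>(1) by real_asymp
  moreover have "\<forall>\<^sub>F x::real in at_top. ln x \<le> c * x" using \<open>0 < c\<close> by real_asymp
  ultimately have "\<forall>\<^sub>F x::real in at_top. x powr (1 + \<delta> / 2) + ln x \<le> x powr (1 + \<delta>) \<and> ln x \<le> c * x"
    by (rule eventually_conj)
  from eventually_compose_filterlim[OF this lim] reg
    eventually_compose_filterlim[OF eventually_gt_at_top[of 1] lim] eventually_ge_at_top[of 1]
  show "\<forall>\<^sub>F t in at_top. phi (on_C1 g) t \<le> phi (on_C1 F) t powr (1 + \<delta>)"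
  proof eventually_elim
    case (elim t)
    define s where "s = 1 / phi (on_C1 F) t"
    define l where "l = ln (phi (on_C1 F) t)"
    have "0 < l" "0 < s" using elim by (auto simp: l_def s_def)
    have "l * s \<le> c * 1" using elim by (simp add: l_def s_def field_simps)
    also have "c * 1 \<le> c * t\<^sup>2" using elim \<open>0 < c\<close> by (intro mult_left_mono) auto
    finally have "s \<le> c * t\<^sup>2 / l" using \<open>0 < l\<close> by (simp add: field_simps)
    then have "phi (on_C1 F) (t + s) \<le> phi (on_C1 F) t powr (1 + \<delta> / 2)"
      using monoD[OF mono, of "t + s" "t + c * t\<^sup>2 / l"] elim(2) unfolding l_def by linarith
    moreover have "ln s = - l" using elim by (simp add: s_def l_def ln_div)
    ultimately show ?case
      using phi_deriv_le[OF \<open>0 < s\<close>, of t] elim unfolding l_def by linarith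
  qed
qed

end

theorem proposition1p14:
  shows "(\<forall>f :: complex ^ 'n \<Rightarrow> complex.
            f \<in> class_C \<and> superquadratic f \<longrightarrow>
              (\<lambda>z. exp (f z)) \<in> class_C \<and>
              (\<lambda>z. sin (f z)) \<in> class_C \<and>
              (\<lambda>z. cos (f z)) \<in> class_C)
       \<and> (\<forall>f :: complex \<Rightarrow> complex.
            on_C1 f \<in> class_C \<and> superquadratic (on_C1 f) \<longrightarrow>
              on_C1 (deriv f) \<in> class_C \<and> superquadratic (on_C1 (deriv f)) \<and>
              (\<forall>F. (\<forall>z. (F has_field_derivative f z) (at z)) \<longrightarrow>
                 on_C1 F \<in> class_C \<and> superquadratic (on_C1 F)))"
proof (intro conjI allI impI; elim conjE)
  fix f :: "complex ^ 'n \<Rightarrow> complex"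
  assume C: "f \<in> class_C" and sq: "superquadratic f"
  then have f: "entire_fun f" by (simp add: class_C_def)
  \<comment> \<open>The two exponentials have moduli exp (-Im w) and exp (Im w). If the first is at
    most 1, the triangle inequality gives the bound; otherwise the left side is at most 1.\<close>
  have trig: "exp (Im w) \<le> norm (exp (\<i> * w) - exp (- (\<i> * w))) + 1"
    "exp (Im w) \<le> norm (exp (\<i> * w) + exp (- (\<i> * w))) + 1" for w
  proof -
    have "exp (Im w) - exp (- Im w) \<le> norm (exp (- (\<i> * w)) - exp (\<i> * w))"
      "exp (Im w) - exp (- Im w) \<le> norm (exp (- (\<i> * w)) + exp (\<i> * w))"
      using norm_triangle_ineq2[of "exp (- (\<i> * w))" "exp (\<i> * w)"]
        norm_diff_ineq[of "exp (- (\<i> * w))" "exp (\<i> * w)"] by simp_all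
    moreover have "exp (Im w) \<le> 1 \<or> exp (- Im w) \<le> 1" by auto
    ultimately show "exp (Im w) \<le> norm (exp (\<i> * w) - exp (- (\<i> * w))) + 1"
      "exp (Im w) \<le> norm (exp (\<i> * w) + exp (- (\<i> * w))) + 1"
      using norm_ge_zero by (smt (verit) add.commute norm_minus_commute)+
  qed
  have upper: "norm (exp (\<i> * w) - exp (- (\<i> * w))) \<le> exp (norm w) * 2"
    "norm (exp (\<i> * w) + exp (- (\<i> * w))) \<le> exp (norm w) * 2" for w
  proof -
    have "norm (exp (\<i> * w)) \<le> exp (norm w)" "norm (exp (- (\<i> * w))) \<le> exp (norm w)"
      using abs_Im_le_cmod[of w] by auto
    then show "norm (exp (\<i> * w) - exp (- (\<i> * w))) \<le> exp (norm w) * 2"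
      "norm (exp (\<i> * w) + exp (- (\<i> * w))) \<le> exp (norm w) * 2"
      using norm_triangle_ineq[of "exp (\<i> * w)" "exp (- (\<i> * w))"]
        norm_triangle_ineq4[of "exp (\<i> * w)" "exp (- (\<i> * w))"] by linarith+
  qed
  show "(\<lambda>z. exp (f z)) \<in> class_C"
  proof (rule class_C_exponential_type_composition[OF C sq, of _ 1])
    show "entire_fun (\<lambda>z. exp (f z))" by (intro entire_fun_compose[OF f] holomorphic_on_exp)
  qed (auto simp: complex_Re_le_cmod)
  show "(\<lambda>z. sin (f z)) \<in> class_C"
  proof (rule class_C_exponential_type_composition[OF C sq, of _ "- \<i>"])
    show "entire_fun (\<lambda>z. sin (f z))" by (intro entire_fun_compose[OF f] holomorphic_on_sin)
  qed (use trig upper in \<open>auto simp: sin_exp_eq norm_divide norm_mult\<close>)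
  show "(\<lambda>z. cos (f z)) \<in> class_C"
  proof (rule class_C_exponential_type_composition[OF C sq, of _ "- \<i>"])
    show "entire_fun (\<lambda>z. cos (f z))" by (intro entire_fun_compose[OF f] holomorphic_on_cos)
  qed (use trig upper in \<open>auto simp: cos_exp_eq norm_divide norm_mult\<close>)
next
  fix f :: "complex \<Rightarrow> complex"
  assume C: "on_C1 f \<in> class_C" and sq: "superquadratic (on_C1 f)"
  have ent: "entire_fun (on_C1 f)" using C by (simp add: class_C_def)
  have hol: "f holomorphic_on UNIV" using holomorphic_if_entire_fun_on_C1[OF ent] .
  obtain z0 where z0: "on_C1 f z0 \<noteq> 0" using superquadratic_nonzero[OF ent sq] .
  have f': "(f has_field_derivative deriv f z) (at z)" for z
    using hol by (simp add: holomorphic_derivI)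
  \<comment> \<open>A vanishing derivative would make f constant and \<open>phi (on_C1 f)\<close>
    bounded, against superquadratic growth.\<close>
  have "\<exists>z. on_C1 (deriv f) z \<noteq> 0"
  proof (rule ccontr)
    assume "\<nexists>z. on_C1 (deriv f) z \<noteq> 0"
    then have "deriv f w = 0" for w by (auto simp: on_C1_def dest: spec[of _ "vec w"])
    then have "norm (f z) \<le> norm (f 0)" for z
      using norm_le_if_deriv_bounded[OF f', of "norm z" 0 z] by simp
    then have "phi (on_C1 f) t \<le> norm (f 0)" for t
      by (intro phi_on_C1_le[OF z0 hol]) (smt (verit) exp_ge_add_one_self)
    moreover have "\<forall>\<^sub>F t in at_top. norm (f 0) < phi (on_C1 f) t"
      using superquadratic_growth_at_top[OF sq[unfolded superquadratic_iff]]
      by (simp add: filterlim_at_top_dense)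
    ultimately have "\<forall>\<^sub>F t::real in at_top. False" by (simp add: not_less[symmetric])
    then show False by simp
  qed
  then obtain z1 where z1: "on_C1 (deriv f) z1 \<noteq> 0" by blast
  show "on_C1 (deriv f) \<in> class_C" "superquadratic (on_C1 (deriv f))"
    using deriv_class_C[OF f' z0 z1 C sq] by auto
  fix F assume "\<forall>z. (F has_field_derivative f z) (at z)"
  then have F: "(F has_field_derivative f z) (at z)" for z by blast
  have "\<exists>z. on_C1 F z \<noteq> 0"
  proof (rule ccontr)
    assume "\<nexists>z. on_C1 F z \<noteq> 0"
    then have "F w = 0" for w by (auto simp: on_C1_def dest: spec[of _ "vec w"])
    then have "F = (\<lambda>_. 0)" by blast
    then have "f z = 0" for z using DERIV_unique[OF F[of z]] by simp
    then show False using z0 by (simp add: on_C1_def)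
  qed
  then obtain z2 where z2: "on_C1 F z2 \<noteq> 0" by blast
  show "on_C1 F \<in> class_C" "superquadratic (on_C1 F)"
    using antiderivative_class_C[OF F z2 z0 C sq] by auto
qed

end
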